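(* Let $\mathcal{A}\subset\mathbb{P}^n$ be a hyperplane arrangement. For any general linear form $\ell\in S$, the residual $$r_{\mathcal{A}}=\Big(f_{\mathcal{A}},\frac{\partial f_{\mathcal{A}}}{\partial\ell}\Big):\mathrm{Jac}(f_{\mathcal{A}})$$ has minimal primary decompositions $$r_{\mathcal{A}}=\bigcap_{P\in S(\mathcal{A})}\Big(\ell_P,\frac{\partial g_P}{\partial\ell}\Big)=\bigcap_{P\in S(\mathcal{A})}\Big(\ell_P,\frac{g_P}{\widetilde{\ell_P}}\Big),$$ where, for each $P$, $\widetilde{\ell_P}$ is any linear divisor of $g_P$.
   Context: $K$ is a field of characteristic zero, $n\ge2$, $S=K[x_0,\dots,x_n]$ with the standard grading. A hyperplane arrangement $\mathcal{A}\subset\mathbb{P}^n$ is a finite nonempty set of distinct hyperplanes, and $f_{\mathcal{A}}$ is the product of linear forms defining them. $\mathrm{Jac}(f_{\mathcal{A}})\subset S$ is the ideal generated by the first partial derivatives of $f_{\mathcal{A}}$. For a linear form $\ell=\sum a_ix_i$, put $\frac{\partial f}{\partial\ell}=\sum_i a_i\frac{\partial f}{\partial x_i}$ and $\ell^\vee=(a_0:\dots:a_n)\in\mathbb{P}^n$. "General $\ell$" means $\ell$ in a suitable nonempty Zariski-open subset of $[S]_1$ depending on $\mathcal{A}$. $S(\mathcal{A})=\{H\cap H' : H\neq H'\in\mathcal{A}\}$ is a set of codimension two linear subspaces. For $P\in S(\mathcal{A})$, $I_P$ is its homogeneous ideal, $g_P$ is the product of the linear factors of $f_{\mathcal{A}}$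 contained in $I_P$, and $\ell_P$ is a linear form defining the hyperplane spanned by $P$ and $\ell^\vee$. *)

theory Defs
  imports "HOL-Analysis.Analysis" "HOL-Library.Poly_Mapping"
begin

text \<open>
  The polynomial ring \<open>S = K[x\<^sub>0, \<dots>, x\<^sub>n]\<close> is the ring of finitely supported maps from exponent
  vectors to coefficients; the variables are indexed by a finite type \<open>'v\<close> with \<open>n + 1\<close> elements.
  A subset of \<open>\<bbbP>\<^sup>n\<close> is represented by its affine cone in \<open>K\<^sup>n\<^sup>+\<^sup>1\<close>, i.e. in \<open>'k ^ 'v\<close>.
\<close>

type_synonym ('k, 'v) mpoly = "('v \<Rightarrow>\<^sub>0 nat) \<Rightarrow>\<^sub>0 'k"

definition eval_mpoly :: "('k::comm_ring_1, 'v::finite) mpoly \<Rightarrow> 'k ^ 'v \<Rightarrow> 'k" where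
  "eval_mpoly p v =
     (\<Sum>m\<in>Poly_Mapping.keys p. Poly_Mapping.lookup p m * (\<Prod>i\<in>UNIV. (v $ i) ^ Poly_Mapping.lookup m i))"

text \<open>When \<open>x\<^sub>i\<close> does not occur in \<open>m\<close>, the exponent \<open>m - e\<^sub>i\<close> is truncated, but the coefficient is \<open>0\<close>.\<close>

definition partial_deriv :: "'v \<Rightarrow> ('k::comm_ring_1, 'v::finite) mpoly \<Rightarrow> ('k, 'v) mpoly" where
  "partial_deriv i p =
     (\<Sum>m\<in>Poly_Mapping.keys p. Poly_Mapping.single (m - Poly_Mapping.single i 1)
        (of_nat (Poly_Mapping.lookup m i) * Poly_Mapping.lookup p m))"

definition homogeneous_of_degree :: "nat \<Rightarrow> ('k::comm_ring_1, 'v::finite) mpoly \<Rightarrow> bool" where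
  "homogeneous_of_degree d p \<longleftrightarrow>
     (\<forall>m\<in>Poly_Mapping.keys p. (\<Sum>i\<in>UNIV. Poly_Mapping.lookup m i) = d)"

definition linear_forms :: "('k::comm_ring_1, 'v::finite) mpoly set" where
  "linear_forms = {p. homogeneous_of_degree 1 p}"

text \<open>The vector \<open>(a\<^sub>0, \<dots>, a\<^sub>n)\<close> of coefficients of \<open>\<ell> = \<Sum> a\<^sub>i x\<^sub>i\<close>; for \<open>\<ell> \<noteq> 0\<close> it represents the point \<open>\<ell>\<^sup>\<or>\<close>.\<close>

definition coeff_vec :: "('k::comm_ring_1, 'v::finite) mpoly \<Rightarrow> 'k ^ 'v" where
  "coeff_vec l = (\<chi> i. Poly_Mapping.lookup l (Poly_Mapping.single i 1))"

definition form_deriv :: "('k::comm_ring_1, 'v::finite) mpoly \<Rightarrow> ('k, 'v) mpoly \<Rightarrow> ('k, 'v) mpoly" where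
  "form_deriv l f = (\<Sum>i\<in>UNIV. Poly_Mapping.single 0 (coeff_vec l $ i) * partial_deriv i f)"

text \<open>Zariski-open subsets of the affine space \<open>[S]\<^sub>1\<close>, with the coefficients as coordinates.\<close>

definition zariski_open_forms :: "('k::field, 'v::finite) mpoly set \<Rightarrow> bool" where
  "zariski_open_forms U \<longleftrightarrow>
     (\<exists>F :: ('k, 'v) mpoly set. U = {l \<in> linear_forms. \<exists>p\<in>F. eval_mpoly p (coeff_vec l) \<noteq> 0})"

text \<open>
  Ideals of a commutative ring are its submodules: \<open>ideal.subspace I\<close> says that \<open>I\<close> is an ideal,
  \<open>ideal.span X\<close> is the ideal generated by \<open>X\<close>.
\<close>

global_interpretation ideal: module "(*) :: 'a::comm_ring_1 \<Rightarrow> 'a \<Rightarrow> 'a"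
  by standard (simp_all add: algebra_simps)

definition colon_ideal :: "'a::comm_ring_1 set \<Rightarrow> 'a set \<Rightarrow> 'a set" where
  "colon_ideal I J = {r. \<forall>s\<in>J. r * s \<in> I}"

definition ideal_radical :: "'a::comm_ring_1 set \<Rightarrow> 'a set" where
  "ideal_radical I = {r. \<exists>k::nat. r ^ k \<in> I}"

definition primary_ideal :: "'a::comm_ring_1 set \<Rightarrow> bool" where
  "primary_ideal Q \<longleftrightarrow> ideal.subspace Q \<and> Q \<noteq> UNIV \<and>
     (\<forall>a b. a * b \<in> Q \<longrightarrow> a \<in> Q \<or> b \<in> ideal_radical Q)"

text \<open>An empty decomposition is one of the unit ideal.\<close>

definition minimal_primary_decomposition ::
    "'a::comm_ring_1 set \<Rightarrow> 'i set \<Rightarrow> ('i \<Rightarrow> 'a set) \<Rightarrow> bool" where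
  "minimal_primary_decomposition I T Q \<longleftrightarrow>
     finite T \<and> I = (\<Inter>P\<in>T. Q P) \<and>
     (\<forall>P\<in>T. primary_ideal (Q P)) \<and>
     inj_on (\<lambda>P. ideal_radical (Q P)) T \<and>
     (\<forall>P\<in>T. \<not> (\<Inter>P'\<in>T - {P}. Q P') \<subseteq> Q P)"

definition defines_hyperplane :: "('k::field, 'v::finite) mpoly \<Rightarrow> ('k ^ 'v) set \<Rightarrow> bool" where
  "defines_hyperplane h H \<longleftrightarrow> h \<in> linear_forms \<and> h \<noteq> 0 \<and> H = {v. eval_mpoly h v = 0}"

definition hyperplane_arrangement :: "('k::field ^ 'v::finite) set set \<Rightarrow> bool" where
  "hyperplane_arrangement A \<longleftrightarrow> finite A \<and> A \<noteq> {} \<and>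
     (\<forall>H\<in>A. \<exists>h. defines_hyperplane h H)"

text \<open>
  In the following \<open>\<alpha>\<close> selects a defining linear form for each hyperplane;
  these forms, hence also the products, are determined up to nonzero scalars.
\<close>

definition arr_poly ::
    "(('k::field ^ 'v::finite) set \<Rightarrow> ('k, 'v) mpoly) \<Rightarrow> ('k ^ 'v) set set \<Rightarrow> ('k, 'v) mpoly" where
  "arr_poly \<alpha> A = (\<Prod>H\<in>A. \<alpha> H)"

definition jacobian_ideal :: "('k::field, 'v::finite) mpoly \<Rightarrow> ('k, 'v) mpoly set" where
  "jacobian_ideal f = ideal.span (range (\<lambda>i. partial_deriv i f))"

definition codim2_intersections :: "('k::field ^ 'v::finite) set set \<Rightarrow> ('k ^ 'v) set set" where
  "codim2_intersections A = {H \<inter> H' | H H'. H \<in> A \<and> H' \<in> A \<and> H \<noteq> H'}"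

definition homogeneous_ideal :: "('k::field ^ 'v::finite) set \<Rightarrow> ('k, 'v) mpoly set" where
  "homogeneous_ideal P =
     ideal.span {p. (\<exists>d. homogeneous_of_degree d p) \<and> (\<forall>v\<in>P. eval_mpoly p v = 0)}"

definition local_poly ::
    "(('k::field ^ 'v::finite) set \<Rightarrow> ('k, 'v) mpoly) \<Rightarrow> ('k ^ 'v) set set \<Rightarrow> ('k ^ 'v) set
       \<Rightarrow> ('k, 'v) mpoly" where
  "local_poly \<alpha> A P = (\<Prod>H\<in>{H \<in> A. \<alpha> H \<in> homogeneous_ideal P}. \<alpha> H)"

definition residual ::
    "(('k::field ^ 'v::finite) set \<Rightarrow> ('k, 'v) mpoly) \<Rightarrow> ('k ^ 'v) set set \<Rightarrow> ('k, 'v) mpoly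
       \<Rightarrow> ('k, 'v) mpoly set" where
  "residual \<alpha> A l =
     colon_ideal (ideal.span {arr_poly \<alpha> A, form_deriv l (arr_poly \<alpha> A)})
       (jacobian_ideal (arr_poly \<alpha> A))"

text \<open>
  \<open>h\<close> is a linear form defining the hyperplane spanned by \<open>P\<close> and the point \<open>\<ell>\<^sup>\<or>\<close>. There is no such
  form if \<open>\<ell>\<^sup>\<or>\<close> lies on \<open>P\<close>.
\<close>

definition defines_join ::
    "('k::field, 'v::finite) mpoly \<Rightarrow> ('k ^ 'v) set \<Rightarrow> ('k, 'v) mpoly \<Rightarrow> bool" where
  "defines_join h P l \<longleftrightarrow> defines_hyperplane h (vec.span (P \<union> {coeff_vec l}))"

end

theory Submission
  imports Defs "HOL-Computational_Algebra.Polynomial"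
begin

text \<open>
  Let \<open>a = \<ell>\<^sup>\<or>\<close>; the only genericity needed is that \<open>a\<close> lies on no \<open>H \<in> \<A>\<close>, i.e. \<open>f\<^sub>\<A>(a) \<noteq> 0\<close>. Let
  \<open>\<beta>\<^sub>H\<close> be the linear form of \<open>H\<close> with \<open>\<beta>\<^sub>H(a) = 1\<close>. Modulo \<open>\<beta>\<^sub>H\<close>, the derivative of \<open>\<Prod>\<beta>\<close> in direction
  \<open>b\<close> is \<open>\<beta>\<^sub>H(b)\<close> times the product of the other forms. Hence \<open>g\<close> lies in the residual iff for each \<open>b\<close>
  some polynomial \<open>u\<close> interpolates the data \<open>u \<equiv> \<beta>\<^sub>H(b) g (mod \<beta>\<^sub>H)\<close>, \<open>H \<in> \<A>\<close>.

  If only the \<open>m\<close> hyperplanes through \<open>P\<close> are considered, put \<open>z = \<ell>\<^sub>P\<close> and let \<open>y\<close> be one of their forms;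
  all of them are \<open>\<beta>\<^sub>H = y - t\<^sub>H z\<close>, and for \<open>\<beta>\<^sub>H(b) = t\<^sub>H\<close> interpolation by \<open>u\<close> means that
  \<open>\<Prod>(y - t\<^sub>H z)\<close> divides \<open>y g - z u\<close>. Reducing modulo \<open>z\<close> this becomes \<open>g \<in> (z, y\<^bsup>m-1\<^esup>)\<close>, which is the
  primary component in both of its descriptions.

  Local interpolation implies global interpolation: the scalars \<open>s\<close> for which \<open>s\<close> times the data can be
  interpolated include \<open>\<Prod>(\<beta>\<^sub>H\<^sub>' - \<beta>\<^sub>H)\<close> by Lagrange's formula, and each factor \<open>z\<close> can be cancelled:
  if \<open>N\<close> interpolates \<open>z s\<close> times the data, the local solutions show \<open>N \<in> (z, \<Prod>\<beta>)\<close>, one class of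
  hyperplanes agreeing on \<open>z = 0\<close> at a time, so that \<open>N\<close> can be divided by \<open>z\<close>.
\<close>

text \<open>For the ring as a module over itself this simp rule reassociates products to the left, against
  \<open>ac_simps\<close> and \<open>algebra_simps\<close>, which then loop.\<close>

declare ideal.scale_scale [simp del]

section \<open>Polynomials as functions\<close>

abbreviation const_mpoly :: "'k \<Rightarrow> ('k::comm_ring_1, 'v::finite) mpoly" where
  "const_mpoly c \<equiv> Poly_Mapping.single 0 c"

lemma mpoly_induct [case_names monom add]:
  fixes p :: "('k::comm_ring_1, 'v::finite) mpoly"
  assumes "\<And>m c. Q (Poly_Mapping.single m c)" and "\<And>p q. Q p \<Longrightarrow> Q q \<Longrightarrow> Q (p + q)"
  shows "Q p"
proof (induction p rule: update_induct)
  case const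
  show ?case using assms(1)[of 0 0] by simp
next
  case (update p m c)
  have "Poly_Mapping.update m c p = p + Poly_Mapping.single m c"
    using update(1)
    by (intro poly_mapping_eqI) (auto simp: lookup_update lookup_add lookup_single when_def in_keys_iff)
  then show ?case using assms update by simp
qed

definition monom_fun :: "('v::finite \<Rightarrow>\<^sub>0 nat) \<Rightarrow> 'k::comm_ring_1 ^ 'v \<Rightarrow> 'k" where
  "monom_fun m v = (\<Prod>i\<in>UNIV. (v $ i) ^ Poly_Mapping.lookup m i)"

lemma monom_fun_add: "monom_fun (m + n) v = monom_fun m v * monom_fun n v"
  by (simp add: monom_fun_def lookup_add power_add prod.distrib)

lemma eval_mpoly_superset:
  assumes "finite S" "Poly_Mapping.keys p \<subseteq> S"
  shows "eval_mpoly p v = (\<Sum>m\<in>S. Poly_Mapping.lookup p m * monom_fun m v)"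
  unfolding eval_mpoly_def monom_fun_def
  by (rule sum.mono_neutral_left) (use assms in \<open>auto simp: in_keys_iff\<close>)

lemma eval_mpoly_add [simp]: "eval_mpoly (p + q) v = eval_mpoly p v + eval_mpoly q v"
proof -
  let ?S = "Poly_Mapping.keys p \<union> Poly_Mapping.keys q"
  have "Poly_Mapping.keys (p + q) \<subseteq> ?S" by (rule keys_add)
  then show ?thesis
    by (simp add: eval_mpoly_superset[of ?S] lookup_add distrib_right sum.distrib)
qed

lemma eval_mpoly_single: "eval_mpoly (Poly_Mapping.single m c) v = c * monom_fun m v"
  by (subst eval_mpoly_superset[of "{m}"]) auto

lemma eval_mpoly_const [simp]: "eval_mpoly (const_mpoly c) v = c"
  by (simp add: eval_mpoly_single monom_fun_def)

lemma eval_mpoly_0 [simp]: "eval_mpoly 0 v = 0"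
  by (simp add: eval_mpoly_def)

lemma eval_mpoly_1 [simp]: "eval_mpoly 1 v = 1"
  by (metis eval_mpoly_const single_one)

lemma eval_mpoly_mult [simp]: "eval_mpoly (p * q) v = eval_mpoly p v * eval_mpoly q v"
proof (induction p rule: mpoly_induct)
  case (monom m c)
  show ?case
  proof (induction q rule: mpoly_induct)
    case (monom n d)
    show ?case unfolding mult_single eval_mpoly_single monom_fun_add by (simp only: ac_simps)
  next
    case (add p q)
    then show ?case unfolding distrib_left eval_mpoly_add by (simp only:)
  qed
next
  case (add p q)
  then show ?case unfolding distrib_right eval_mpoly_add by (simp only:)
qed

lemma eval_mpoly_uminus [simp]: "eval_mpoly (- p) v = - eval_mpoly p v"
proof -
  have "eval_mpoly p v + eval_mpoly (- p) v = 0"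
    by (simp flip: eval_mpoly_add)
  then show ?thesis by (metis minus_unique)
qed

lemma eval_mpoly_diff [simp]: "eval_mpoly (p - q) v = eval_mpoly p v - eval_mpoly q v"
  using eval_mpoly_add[of p "- q" v] by simp

lemma eval_mpoly_power [simp]: "eval_mpoly (p ^ n) v = eval_mpoly p v ^ n"
  by (induction n) simp_all

lemma eval_mpoly_prod: "eval_mpoly (\<Prod>x\<in>T. f x) v = (\<Prod>x\<in>T. eval_mpoly (f x) v)"
  by (induction T rule: infinite_finite_induct) simp_all

text \<open>A monomial is built by adjoining one new variable at a time, and a power of a variable
  by repeated multiplication. This form suits claims compatible with the ring operations, such as
  substitution.\<close>

lemma mpoly_ring_induct [case_names const var add mult]:
  fixes p :: "('k::comm_ring_1, 'v::finite) mpoly"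
  assumes const: "\<And>c. Q (const_mpoly c)" and var: "\<And>i. Q (Poly_Mapping.single (Poly_Mapping.single i 1) 1)"
    and add: "\<And>p q. Q p \<Longrightarrow> Q q \<Longrightarrow> Q (p + q)" and mult: "\<And>p q. Q p \<Longrightarrow> Q q \<Longrightarrow> Q (p * q)"
  shows "Q p"
proof (induction p rule: mpoly_induct)
  case (monom m c)
  show ?case
  proof (induction m arbitrary: c rule: update_induct)
    case const
    show ?case by (rule assms)
  next
    case (update m i k)
    have eq: "Poly_Mapping.update i k m = m + Poly_Mapping.single i k"
      using update(1)
      by (intro poly_mapping_eqI) (auto simp: lookup_update lookup_add lookup_single when_def in_keys_iff)
    have "Q (Poly_Mapping.single (Poly_Mapping.single i k) 1)"
    proof (induction k)
      case 0
      then show ?case using const[of 1] by simp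
    next
      case (Suc k)
      have "Poly_Mapping.single (Poly_Mapping.single i (Suc k)) 1 =
         Poly_Mapping.single (Poly_Mapping.single i k) 1 *
         (Poly_Mapping.single (Poly_Mapping.single i 1) 1 :: ('k,'v) mpoly)"
        by (simp add: mult_single flip: single_add)
      then show ?case using mult[OF Suc var] by simp
    qed
    from mult[OF update(3)[of c] this] show ?case by (simp add: eq mult_single)
  qed
qed (use add in blast)

text \<open>Distinct monomials are distinct characters, so Artin's argument for their independence applies.\<close>

lemma monom_fun_independent:
  fixes c :: "('v::finite \<Rightarrow>\<^sub>0 nat) \<Rightarrow> 'k::field_char_0"
  assumes "finite M" "\<And>v. (\<Sum>m\<in>M. c m * monom_fun m v) = 0" "m \<in> M"
  shows "c m = 0"
  using assms
proof (induction M arbitrary: c m rule: finite_induct)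
  case (insert m0 M)
  have M0: "c n = 0" if n: "n \<in> M" for n
  proof -
    have "n \<noteq> m0" using n insert.hyps by blast
    then obtain i where i: "Poly_Mapping.lookup n i \<noteq> Poly_Mapping.lookup m0 i"
      by (meson poly_mapping_eqI)
    \<comment> \<open>At this point a monomial takes the value 2 to the power of its exponent at
      \<open>i\<close>, so in characteristic zero it separates \<open>n\<close> from
      \<open>m0\<close>.\<close>
    define v :: "'k ^ 'v" where "v = (\<chi> j. if j = i then 2 else 1)"
    have mv: "monom_fun n' v = 2 ^ Poly_Mapping.lookup n' i" for n'
    proof -
      have "monom_fun n' v = (\<Prod>j\<in>UNIV. if j = i then 2 ^ Poly_Mapping.lookup n' j else 1)"
        unfolding monom_fun_def v_def by (intro prod.cong) auto
      then show ?thesis by simp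
    qed
    \<comment> \<open>The relation at the coordinatewise product of \<open>v\<close> and
      \<open>w\<close>, minus \<open>monom_fun m0 v\<close> times the relation at \<open>w\<close>,
      has no \<open>m0\<close> term. This leaves a relation over \<open>M\<close> alone.\<close>
    have "(\<Sum>m\<in>M. (c m * (monom_fun m v - monom_fun m0 v)) * monom_fun m w) = 0" for w
    proof -
      have "monom_fun m (\<chi> j. v $ j * w $ j) = monom_fun m v * monom_fun m w" for m
        by (simp add: monom_fun_def power_mult_distrib prod.distrib)
      then have 1: "c m0 * (monom_fun m0 v * monom_fun m0 w) +
          (\<Sum>m\<in>M. c m * (monom_fun m v * monom_fun m w)) = 0"
        using insert.prems(1)[of "\<chi> j. v $ j * w $ j"] insert.hyps by simp
      have "monom_fun m0 v * (c m0 * monom_fun m0 w + (\<Sum>m\<in>M. c m * monom_fun m w)) = 0"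
        using insert.prems(1)[of w] insert.hyps by simp
      then have 2: "c m0 * (monom_fun m0 v * monom_fun m0 w) +
          (\<Sum>m\<in>M. monom_fun m0 v * (c m * monom_fun m w)) = 0"
        unfolding distrib_left sum_distrib_left
          mult.left_commute[of "monom_fun m0 v" "c m0" "monom_fun m0 w"] .
      have eq: "x * (a - b) * d = x * (a * d) - b * (x * d)" for x a b d :: 'k
        by (simp add: algebra_simps)
      have "(\<Sum>m\<in>M. (c m * (monom_fun m v - monom_fun m0 v)) * monom_fun m w) =
          (\<Sum>m\<in>M. c m * (monom_fun m v * monom_fun m w)) -
          (\<Sum>m\<in>M. monom_fun m0 v * (c m * monom_fun m w))"
        by (simp only: eq sum_subtractf)
      also have "\<dots> = 0"
        using add_left_imp_eq[OF trans[OF 1 2[symmetric]]] by (rule eq_iff_diff_eq_0[THEN iffD1])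
      finally show ?thesis .
    qed
    from insert.IH[OF this n] have "c n * (monom_fun n v - monom_fun m0 v) = 0" .
    moreover have "(2::'k) ^ Poly_Mapping.lookup n i \<noteq> 2 ^ Poly_Mapping.lookup m0 i"
    proof -
      have "(2::nat) ^ Poly_Mapping.lookup n i \<noteq> 2 ^ Poly_Mapping.lookup m0 i" using i by simp
      then have "of_nat (2 ^ Poly_Mapping.lookup n i) \<noteq> (of_nat (2 ^ Poly_Mapping.lookup m0 i) :: 'k)"
        by (simp only: of_nat_eq_iff not_False_eq_True)
      then show ?thesis by (simp only: of_nat_power of_nat_numeral not_False_eq_True)
    qed
    ultimately show ?thesis unfolding mv by simp
  qed
  have "monom_fun n (\<chi> i. (1 :: 'k)) = 1" for n :: "'v \<Rightarrow>\<^sub>0 nat"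
    by (simp add: monom_fun_def)
  moreover have "(\<Sum>m\<in>M. c m) = 0"
    using M0 by (rule sum.neutral[rule_format])
  ultimately have "c m0 = 0"
    using insert.prems(1)[of "\<chi> i. 1"] insert.hyps by simp
  then show ?case using M0 insert.prems(2) by auto
qed simp

lemma eval_mpoly_eq_0D:
  fixes p :: "('k::field_char_0, 'v::finite) mpoly"
  assumes "\<And>v. eval_mpoly p v = 0"
  shows "p = 0"
proof (intro poly_mapping_eqI)
  fix m
  have "Poly_Mapping.lookup p m = 0" if "m \<in> Poly_Mapping.keys p"
    by (rule monom_fun_independent[OF finite_keys _ that])
       (use assms in \<open>simp add: eval_mpoly_superset[OF finite_keys order_refl]\<close>)
  then show "Poly_Mapping.lookup p m = Poly_Mapping.lookup 0 m"
    by (metis in_keys_iff lookup_zero)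
qed

lemma mpoly_eqI:
  fixes p q :: "('k::field_char_0, 'v::finite) mpoly"
  assumes "\<And>v. eval_mpoly p v = eval_mpoly q v"
  shows "p = q"
  using eval_mpoly_eq_0D[of "p - q"] assms by simp

text \<open>Restriction to a line reduces questions about zeros to univariate polynomials, which
  have finitely many roots unless they are zero.\<close>

lemma eval_mpoly_on_line:
  fixes p :: "('k::field_char_0, 'v::finite) mpoly"
  shows "\<exists>P. \<forall>t. eval_mpoly p (v + t *s w) = poly P t"
proof (induction p rule: mpoly_ring_induct)
  case (const c)
  show ?case by (rule exI[of _ "[:c:]"]) simp
next
  case (var i)
  have "monom_fun (Poly_Mapping.single i 1) (x :: 'k ^ 'v) = x $ i" for x
    by (simp add: monom_fun_def lookup_single when_def if_distrib[where f="\<lambda>n. _ ^ n"] prod.If_cases)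
  then show ?case by (intro exI[of _ "[:v $ i, w $ i:]"]) (simp add: eval_mpoly_single algebra_simps)
next
  case (add p q)
  then show ?case by (metis eval_mpoly_add poly_add)
next
  case (mult p q)
  then show ?case by (metis eval_mpoly_mult poly_mult)
qed

definition vanishes_on :: "('k::comm_ring_1, 'v::finite) mpoly \<Rightarrow> ('k ^ 'v) set \<Rightarrow> bool" where
  "vanishes_on p W \<longleftrightarrow> (\<forall>v\<in>W. eval_mpoly p v = 0)"

text \<open>On the line through a point where \<open>p\<close> does not vanish and one where \<open>q\<close> does not, only
  finitely many points are zeros of \<open>p q\<close>.\<close>

lemma vanishes_on_multD:
  fixes p q :: "('k::field_char_0, 'v::finite) mpoly"
  assumes W: "vec.subspace W" and pq: "vanishes_on (p * q) W"
  shows "vanishes_on p W \<or> vanishes_on q W"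
proof (rule ccontr)
  assume "\<not> ?thesis"
  then obtain v w where vw: "v \<in> W" "w \<in> W" "eval_mpoly p v \<noteq> 0" "eval_mpoly q w \<noteq> 0"
    by (auto simp: vanishes_on_def)
  obtain P where P: "\<And>t. eval_mpoly p (v + t *s (w - v)) = poly P t"
    using eval_mpoly_on_line[of p v "w - v"] by blast
  obtain Q where Q: "\<And>t. eval_mpoly q (v + t *s (w - v)) = poly Q t"
    using eval_mpoly_on_line[of q v "w - v"] by blast
  have "poly P 0 \<noteq> 0" "poly Q 1 \<noteq> 0" using P[of 0] Q[of 1] vw by simp_all
  then have "P * Q \<noteq> 0" by auto
  then have "finite {t. poly (P * Q) t = 0}" by (rule poly_roots_finite)
  from ex_new_if_finite[OF infinite_UNIV_char_0 this] obtain t where "poly (P * Q) t \<noteq> 0"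
    by blast
  then have "eval_mpoly (p * q) (v + t *s (w - v)) \<noteq> 0" using P Q by simp
  moreover have "v + t *s (w - v) \<in> W"
    by (intro vec.subspace_add vec.subspace_diff vec.subspace_scale W vw)
  ultimately show False using pq unfolding vanishes_on_def by blast
qed

lemma vanishes_on_prodD:
  fixes f :: "'i \<Rightarrow> ('k::field_char_0, 'v::finite) mpoly"
  assumes W: "vec.subspace W" and T: "finite T" and "vanishes_on (\<Prod>x\<in>T. f x) W"
  shows "\<exists>x\<in>T. vanishes_on (f x) W"
  using T assms(3)
proof (induction T rule: finite_induct)
  case empty
  then show ?case using vec.subspace_0[OF W] by (auto simp: vanishes_on_def)
next
  case (insert x T)
  then show ?case using vanishes_on_multD[OF W, of "f x" "prod f T"] by auto
qed

lemma vanishes_on_UNIV_iff: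
  fixes p :: "('k::field_char_0, 'v::finite) mpoly"
  shows "vanishes_on p UNIV \<longleftrightarrow> p = 0"
  by (auto simp: vanishes_on_def intro: eval_mpoly_eq_0D)

lemma mpoly_mult_eq_0D:
  fixes p q :: "('k::field_char_0, 'v::finite) mpoly"
  shows "p * q = 0 \<Longrightarrow> p = 0 \<or> q = 0"
  using vanishes_on_multD[OF vec.subspace_UNIV, of p q] by (simp add: vanishes_on_UNIV_iff)

section \<open>Linear forms and ideals generated by them\<close>

text \<open>An exponent vector of total degree 1 is a unit vector, so the coefficients at unit
  vectors determine the form.\<close>

lemma linear_form_expand:
  assumes "p \<in> linear_forms"
  shows "p = (\<Sum>i\<in>UNIV. Poly_Mapping.single (Poly_Mapping.single i 1) (coeff_vec p $ i))"
proof (intro poly_mapping_eqI)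
  fix m
  have "Poly_Mapping.lookup (\<Sum>i\<in>UNIV. Poly_Mapping.single (Poly_Mapping.single i 1) (coeff_vec p $ i)) m
      = (\<Sum>i\<in>UNIV. if Poly_Mapping.single i 1 = m then Poly_Mapping.lookup p m else 0)" (is "_ = ?S")
    by (auto simp: lookup_sum lookup_single coeff_vec_def when_def intro!: sum.cong)
  also have "?S = Poly_Mapping.lookup p m"
  proof (cases "m \<in> Poly_Mapping.keys p")
    case True
    then have "(\<Sum>i\<in>UNIV. Poly_Mapping.lookup m i) = 1"
      using assms by (auto simp: linear_forms_def homogeneous_of_degree_def)
    then obtain i where i: "Poly_Mapping.lookup m i = 1" "\<And>j. j \<noteq> i \<Longrightarrow> Poly_Mapping.lookup m j = 0"
      unfolding sum_eq_1_iff[OF finite] by (metis UNIV_I)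
    have m: "m = Poly_Mapping.single i 1"
      by (intro poly_mapping_eqI) (use i in \<open>auto simp: lookup_single when_def\<close>)
    have "Poly_Mapping.single j (1::nat) = m \<longleftrightarrow> j = i" for j
      unfolding m by (metis lookup_single_eq lookup_single_not_eq zero_neq_one)
    then show ?thesis by simp
  next
    case False
    then have "Poly_Mapping.lookup p m = 0" by (simp add: in_keys_iff)
    then show ?thesis by (simp only: if_cancel sum.neutral_const)
  qed
  finally show "Poly_Mapping.lookup p m = Poly_Mapping.lookup
      (\<Sum>i\<in>UNIV. Poly_Mapping.single (Poly_Mapping.single i 1) (coeff_vec p $ i)) m" ..
qed

lemma eval_mpoly_sum: "eval_mpoly (\<Sum>x\<in>T. f x) v = (\<Sum>x\<in>T. eval_mpoly (f x) v)"
  by (induction T rule: infinite_finite_induct) simp_all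

lemma eval_mpoly_var: "eval_mpoly (Poly_Mapping.single (Poly_Mapping.single i (Suc 0)) c) v = c * v $ i"
proof -
  have "monom_fun (Poly_Mapping.single i (Suc 0)) v = (\<Prod>j\<in>UNIV. if j = i then v $ j else 1)"
    unfolding monom_fun_def by (intro prod.cong) (auto simp: lookup_single when_def)
  then show ?thesis by (simp add: eval_mpoly_single)
qed

lemma eval_linear_form:
  assumes "p \<in> linear_forms"
  shows "eval_mpoly p v = (\<Sum>i\<in>UNIV. coeff_vec p $ i * v $ i)"
  by (subst linear_form_expand[OF assms]) (simp add: eval_mpoly_sum eval_mpoly_var)

lemma linear_form_add [simp]: "p \<in> linear_forms \<Longrightarrow> eval_mpoly p (u + v) = eval_mpoly p u + eval_mpoly p v"
  by (simp add: eval_linear_form algebra_simps sum.distrib)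

lemma linear_form_scale [simp]: "p \<in> linear_forms \<Longrightarrow> eval_mpoly p (c *s v) = c * eval_mpoly p v"
  by (simp add: eval_linear_form sum_distrib_left mult_ac)

lemma linear_form_diff [simp]: "p \<in> linear_forms \<Longrightarrow> eval_mpoly p (u - v) = eval_mpoly p u - eval_mpoly p v"
  by (simp add: eval_linear_form algebra_simps sum_subtractf)

lemma linear_form_uminus [simp]: "p \<in> linear_forms \<Longrightarrow> eval_mpoly p (- v) = - eval_mpoly p v"
  by (simp add: eval_linear_form sum_negf)

lemma linear_form_0 [simp]: "p \<in> linear_forms \<Longrightarrow> eval_mpoly p 0 = 0"
  by (simp add: eval_linear_form)

lemma linear_forms_diff: "p \<in> linear_forms \<Longrightarrow> q \<in> linear_forms \<Longrightarrow> p - q \<in> linear_forms"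
  using keys_diff[of p q] unfolding linear_forms_def homogeneous_of_degree_def by blast

lemma linear_forms_const_mult:
  assumes "p \<in> linear_forms" shows "const_mpoly c * p \<in> linear_forms"
proof -
  have "Poly_Mapping.keys (const_mpoly c * p) \<subseteq> Poly_Mapping.keys p"
    using keys_mult[of "const_mpoly c" p] by (auto split: if_splits)
  then show ?thesis using assms unfolding linear_forms_def homogeneous_of_degree_def by blast
qed

lemma subspace_linear_form_kernel:
  "p \<in> linear_forms \<Longrightarrow> vec.subspace {v. eval_mpoly p v = 0}"
  by (simp add: vec.subspace_def)

lemma coeff_vec_surj:
  fixes v :: "'k::comm_ring_1 ^ 'v::finite"
  shows "\<exists>l\<in>linear_forms. coeff_vec l = v"
proof
  let ?l = "\<Sum>i\<in>UNIV. Poly_Mapping.single (Poly_Mapping.single i (Suc 0)) (v $ i)"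
  have eq: "Poly_Mapping.single i (Suc 0) = Poly_Mapping.single j (Suc 0) \<longleftrightarrow> i = j" for i j :: 'v
    by (metis lookup_single_eq lookup_single_not_eq nat.distinct(1))
  show "coeff_vec ?l = v"
    by (simp add: coeff_vec_def vec_eq_iff lookup_sum lookup_single when_def eq)
  show "?l \<in> linear_forms"
    unfolding linear_forms_def homogeneous_of_degree_def
  proof safe
    fix m assume "m \<in> Poly_Mapping.keys ?l"
    then obtain i where "m = Poly_Mapping.single i (Suc 0)"
      using keys_sum[of "\<lambda>i. Poly_Mapping.single (Poly_Mapping.single i (Suc 0)) (v $ i)" UNIV]
      by (auto split: if_splits)
    then show "(\<Sum>i\<in>UNIV. Poly_Mapping.lookup m i) = 1"
      by (simp add: lookup_single when_def)
  qed
qed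

text \<open>Fix \<open>b\<close> with \<open>p\<close> nonzero at \<open>b\<close>. Every vector is
  a multiple of \<open>b\<close> plus a zero of \<open>p\<close>, hence \<open>q\<close> is
  determined by its value at \<open>b\<close>.\<close>

lemma linear_form_proportional:
  fixes p q :: "('k::field_char_0, 'v::finite) mpoly"
  assumes p: "p \<in> linear_forms" "p \<noteq> 0" and q: "q \<in> linear_forms"
    and sub: "\<And>v. eval_mpoly p v = 0 \<Longrightarrow> eval_mpoly q v = 0"
  shows "\<exists>k. q = const_mpoly k * p"
proof -
  obtain b where b: "eval_mpoly p b \<noteq> 0" using p eval_mpoly_eq_0D by blast
  have "eval_mpoly q v = eval_mpoly q b / eval_mpoly p b * eval_mpoly p v" for v
  proof -
    have "eval_mpoly p (v - (eval_mpoly p v / eval_mpoly p b) *s b) = 0"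
      using b by (simp add: p(1))
    from sub[OF this] have "eval_mpoly q v = eval_mpoly p v / eval_mpoly p b * eval_mpoly q b"
      by (simp only: linear_form_diff[OF q] linear_form_scale[OF q] eq_iff_diff_eq_0[symmetric])
    then show ?thesis by (simp add: mult.commute)
  qed
  then have "q = const_mpoly (eval_mpoly q b / eval_mpoly p b) * p"
    by (intro mpoly_eqI) (unfold eval_mpoly_mult eval_mpoly_const)
  then show ?thesis by blast
qed

text \<open>The substitution changes each variable by a multiple of \<open>z\<close>, and congruence
  modulo \<open>z\<close> is preserved by sums and products. For a linear form \<open>z\<close> with
  value 1 at \<open>b\<close>, it is the projection along \<open>b\<close> onto the kernel of
  \<open>z\<close>.\<close>

lemma substitute_along:
  fixes z p :: "('k::comm_ring_1, 'v::finite) mpoly"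
  shows "\<exists>q. z dvd p - q \<and> (\<forall>v. eval_mpoly q v = eval_mpoly p (v - eval_mpoly z v *s b))"
proof (induction p rule: mpoly_ring_induct)
  case (const c)
  show ?case by (rule exI[of _ "const_mpoly c"]) simp
next
  case (var i)
  show ?case
    by (rule exI[of _ "Poly_Mapping.single (Poly_Mapping.single i 1) 1 - z * const_mpoly (b $ i)"])
      (simp add: eval_mpoly_var)
next
  case (add p1 p2)
  then obtain q1 q2 where q: "z dvd p1 - q1" "z dvd p2 - q2"
    "\<And>v. eval_mpoly q1 v = eval_mpoly p1 (v - eval_mpoly z v *s b)"
    "\<And>v. eval_mpoly q2 v = eval_mpoly p2 (v - eval_mpoly z v *s b)" by blast
  have "p1 + p2 - (q1 + q2) = (p1 - q1) + (p2 - q2)" by simp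
  then have "z dvd p1 + p2 - (q1 + q2)" using q dvd_add by metis
  then show ?case using q by (intro exI[of _ "q1 + q2"]) simp
next
  case (mult p1 p2)
  then obtain q1 q2 where q: "z dvd p1 - q1" "z dvd p2 - q2"
    "\<And>v. eval_mpoly q1 v = eval_mpoly p1 (v - eval_mpoly z v *s b)"
    "\<And>v. eval_mpoly q2 v = eval_mpoly p2 (v - eval_mpoly z v *s b)" by blast
  have "p1 * p2 - q1 * q2 = p1 * (p2 - q2) + (p1 - q1) * q2" by (simp add: algebra_simps)
  then have "z dvd p1 * p2 - q1 * q2" using q by (metis dvd_add dvd_mult dvd_mult2)
  then show ?case using q by (intro exI[of _ "q1 * q2"]) simp
qed

text \<open>After scaling \<open>b\<close> so that \<open>z\<close> is 1 there, projecting along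
  \<open>b\<close> onto the kernel of \<open>z\<close> turns \<open>p\<close> into a polynomial
  vanishing everywhere, hence into 0; it is still congruent to \<open>p\<close> modulo
  \<open>z\<close>.\<close>

lemma linear_form_dvd_iff:
  fixes z p :: "('k::field_char_0, 'v::finite) mpoly"
  assumes z: "z \<in> linear_forms" "z \<noteq> 0"
  shows "z dvd p \<longleftrightarrow> vanishes_on p {v. eval_mpoly z v = 0}"
proof
  assume "vanishes_on p {v. eval_mpoly z v = 0}"
  obtain b where b: "eval_mpoly z b \<noteq> 0" using z eval_mpoly_eq_0D by blast
  obtain q where q: "z dvd p - q"
    "\<And>v. eval_mpoly q v = eval_mpoly p (v - eval_mpoly z v *s ((1 / eval_mpoly z b) *s b))"
    using substitute_along[of z p "(1 / eval_mpoly z b) *s b"] by blast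
  have "eval_mpoly q v = 0" for v
  proof -
    have "eval_mpoly z (v - eval_mpoly z v *s ((1 / eval_mpoly z b) *s b)) = 0"
      using z b by simp
    then show ?thesis
      using \<open>vanishes_on p _\<close> unfolding q(2) vanishes_on_def by blast
  qed
  then have "q = 0" by (rule eval_mpoly_eq_0D)
  then show "z dvd p" using q by simp
qed (auto simp: vanishes_on_def elim!: dvdE)

lemma linear_form_prime:
  fixes z p :: "('k::field_char_0, 'v::finite) mpoly"
  assumes z: "z \<in> linear_forms" "z \<noteq> 0" and "z dvd p * q"
  shows "z dvd p \<or> z dvd q"
  using assms vanishes_on_multD[OF subspace_linear_form_kernel[OF z(1)]]
  by (simp add: linear_form_dvd_iff)

section \<open>Ideals with two generators, handled as congruences modulo the first one\<close>

lemma mem_ideal_span2_iff: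
  fixes z w x :: "'a::comm_ring_1"
  shows "x \<in> ideal.span {z, w} \<longleftrightarrow> (\<exists>s. z dvd x - s * w)"
proof -
  have "x \<in> ideal.span {z, w} \<longleftrightarrow> (\<exists>r s. x - r * z = s * w)"
    by (auto simp: ideal.span_insert ideal.span_singleton)
  also have "\<dots> \<longleftrightarrow> (\<exists>s r. x - s * w = z * r)"
    by (auto simp: algebra_simps) (metis add.commute mult.commute)+
  finally show ?thesis by (simp add: dvd_def)
qed

lemma mem_ideal_span_linear_forms_iff:
  fixes z y p :: "('k::field_char_0, 'v::finite) mpoly"
  assumes z: "z \<in> linear_forms" "z \<noteq> 0" and y: "y \<in> linear_forms" and "\<not> z dvd y"
  shows "p \<in> ideal.span {z, y} \<longleftrightarrow> vanishes_on p {v. eval_mpoly z v = 0 \<and> eval_mpoly y v = 0}"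
proof
  assume p: "vanishes_on p {v. eval_mpoly z v = 0 \<and> eval_mpoly y v = 0}"
  \<comment> \<open>Since \<open>z\<close> does not divide \<open>y\<close>, the form
    \<open>y\<close> is nonzero somewhere on the kernel of \<open>z\<close>. Projecting along such a
    direction eliminates \<open>y\<close> without leaving that kernel.\<close>
  obtain b where b: "eval_mpoly z b = 0" "eval_mpoly y b \<noteq> 0"
    using assms by (auto simp: linear_form_dvd_iff vanishes_on_def)
  let ?c = "(1 / eval_mpoly y b) *s b"
  obtain q where q: "y dvd p - q"
    "\<And>v. eval_mpoly q v = eval_mpoly p (v - eval_mpoly y v *s ?c)"
    using substitute_along[of y p ?c] by blast
  have "eval_mpoly q v = 0" if "eval_mpoly z v = 0" for v
  proof -
    have "eval_mpoly z (v - eval_mpoly y v *s ?c) = 0" "eval_mpoly y (v - eval_mpoly y v *s ?c) = 0"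
      using z y b that by simp_all
    then show ?thesis
      using p unfolding q(2) vanishes_on_def by blast
  qed
  then have "z dvd q" by (simp add: linear_form_dvd_iff z vanishes_on_def)
  moreover obtain s where "p - q = y * s" using q by blast
  then have "q = p - s * y" by (simp add: algebra_simps)
  ultimately show "p \<in> ideal.span {z, y}" by (auto simp: mem_ideal_span2_iff)
next
  assume "p \<in> ideal.span {z, y}"
  then obtain s r where "p - s * y = z * r" by (auto simp: mem_ideal_span2_iff elim: dvdE)
  then have "p = s * y + z * r" by (simp add: algebra_simps)
  then show "vanishes_on p {v. eval_mpoly z v = 0 \<and> eval_mpoly y v = 0}"
    by (simp add: vanishes_on_def)
qed

text \<open>The ideal consists of all polynomials vanishing on a linear subspace, and
  \<open>vanishes_on_multD\<close> says that linear subspaces are irreducible.\<close>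

lemma ideal_span_linear_forms_prime:
  fixes z y :: "('k::field_char_0, 'v::finite) mpoly"
  assumes z: "z \<in> linear_forms" "z \<noteq> 0" and y: "y \<in> linear_forms" and "\<not> z dvd y"
    and "a * b \<in> ideal.span {z, y}"
  shows "a \<in> ideal.span {z, y} \<or> b \<in> ideal.span {z, y}"
proof -
  have "vec.subspace {v. eval_mpoly z v = 0 \<and> eval_mpoly y v = 0}"
    using z y by (simp add: vec.subspace_def)
  from vanishes_on_multD[OF this] show ?thesis
    using assms by (simp add: mem_ideal_span_linear_forms_iff)
qed

text \<open>The second generator matters only modulo \<open>z\<close> and up to the unit
  \<open>c\<close>, whose inverse is \<open>u\<close>. This later replaces products and derivatives
  by a power of a single form.\<close>

lemma ideal_span2_cong:
  fixes z q w :: "'a::comm_ring_1"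
  assumes "z dvd q - c * w" "u * c = 1"
  shows "ideal.span {z, q} = ideal.span {z, w}"
proof -
  obtain r where r: "q - c * w = z * r" using assms by blast
  have q: "q = r * z + c * w" using r by (simp add: algebra_simps)
  have "u * q = u * r * z + (u * c) * w" by (simp add: q algebra_simps)
  then have "w = u * q - u * r * z" by (simp add: assms(2))
  have "ideal.span {z, q} \<subseteq> ideal.span {z, w}"
    by (rule ideal.span_minimal)
      (auto intro: ideal.span_base ideal.span_add ideal.span_scale simp: q)
  moreover have "w \<in> ideal.span {z, q}"
    by (subst \<open>w = _\<close>) (auto intro: ideal.span_base ideal.span_diff ideal.span_scale)
  then have "ideal.span {z, w} \<subseteq> ideal.span {z, q}"
    by (intro ideal.span_minimal) (auto intro: ideal.span_base)
  ultimately show ?thesis by blast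
qed

text \<open>Induction on \<open>k\<close>: primality of \<open>(z, y)\<close> gives
  \<open>a = a' y\<close> modulo \<open>z\<close>, a factor \<open>y\<close> cancels because
  \<open>z\<close> is prime and does not divide it, and \<open>a'\<close> is covered by the
  induction hypothesis. It yields primariness of \<open>(z, y^k)\<close> and also separates
  different classes of hyperplanes in \<open>global_interpolation\<close>.\<close>

lemma cancel_mod_power:
  fixes z y a b :: "'a::comm_ring_1"
  assumes prime_z: "\<And>a b. z dvd a * b \<Longrightarrow> z dvd a \<or> z dvd b" and y: "\<not> z dvd y"
    and prime_zy: "\<And>a b. a * b \<in> ideal.span {z, y} \<Longrightarrow> a \<in> ideal.span {z, y} \<or> b \<in> ideal.span {z, y}"
    and b: "b \<notin> ideal.span {z, y}"
  shows "a * b \<in> ideal.span {z, y ^ k} \<Longrightarrow> a \<in> ideal.span {z, y ^ k}"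
proof (induction k arbitrary: a)
  case 0
  show ?case by (auto simp: mem_ideal_span2_iff intro: exI[of _ a])
next
  case (Suc k)
  then obtain s where s: "z dvd a * b - s * y ^ Suc k" by (auto simp: mem_ideal_span2_iff)
  then have "a * b \<in> ideal.span {z, y}"
    by (auto simp: mem_ideal_span2_iff mult_ac intro!: exI[of _ "s * y ^ k"])
  then have "a \<in> ideal.span {z, y}" using prime_zy b by blast
  then obtain a' where a': "z dvd a - a' * y" by (auto simp: mem_ideal_span2_iff)
  have "z dvd (a * b - s * y ^ Suc k) - (a - a' * y) * b"
    by (rule dvd_diff[OF s dvd_mult2[OF a']])
  also have "(a * b - s * y ^ Suc k) - (a - a' * y) * b = y * (a' * b - s * y ^ k)"
    by (simp add: algebra_simps)
  finally have "z dvd a' * b - s * y ^ k" using prime_z y by blast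
  then have "a' * b \<in> ideal.span {z, y ^ k}" by (auto simp: mem_ideal_span2_iff)
  then have "a' \<in> ideal.span {z, y ^ k}" by (rule Suc.IH)
  then obtain t where "z dvd a' - t * y ^ k" by (auto simp: mem_ideal_span2_iff)
  then have "z dvd (a - a' * y) + (a' - t * y ^ k) * y" using a' by simp
  also have "(a - a' * y) + (a' - t * y ^ k) * y = a - t * y ^ Suc k" by (simp add: algebra_simps)
  finally show ?case by (auto simp: mem_ideal_span2_iff)
qed

lemma power_mem_span_power:
  fixes z y b :: "'a::comm_ring_1"
  assumes "b \<in> ideal.span {z, y}"
  shows "b ^ k \<in> ideal.span {z, y ^ k}"
proof -
  obtain s where s: "z dvd b - s * y" using assms by (auto simp: mem_ideal_span2_iff)
  have "b - s * y dvd b ^ k - (s * y) ^ k"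
    by (simp add: power_diff_sumr2)
  then have "z dvd b ^ k - s ^ k * y ^ k"
    using dvd_trans[OF s] by (simp add: power_mult_distrib)
  then show ?thesis by (auto simp: mem_ideal_span2_iff)
qed

lemma ideal_radical_span_power:
  fixes z y :: "'a::comm_ring_1"
  assumes prime_zy: "\<And>a b. a * b \<in> ideal.span {z, y} \<Longrightarrow> a \<in> ideal.span {z, y} \<or> b \<in> ideal.span {z, y}"
    and one: "1 \<notin> ideal.span {z, y}" and k: "k > 0"
  shows "ideal_radical (ideal.span {z, y ^ k}) = ideal.span {z, y}"
proof (intro equalityI subsetI)
  fix r assume "r \<in> ideal_radical (ideal.span {z, y ^ k})"
  then obtain n where n: "r ^ n \<in> ideal.span {z, y ^ k}" by (auto simp: ideal_radical_def)
  have "y ^ k \<in> ideal.span {z, y}"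
    unfolding mem_ideal_span2_iff using k by (intro exI[of _ "y ^ (k - 1)"]) (simp flip: power_Suc2)
  then have "ideal.span {z, y ^ k} \<subseteq> ideal.span {z, y}"
    by (intro ideal.span_minimal) (auto intro: ideal.span_base)
  then have "r ^ n \<in> ideal.span {z, y}" using n by blast
  then show "r \<in> ideal.span {z, y}"
    by (induction n) (use one prime_zy in auto)
next
  fix r assume "r \<in> ideal.span {z, y}"
  then show "r \<in> ideal_radical (ideal.span {z, y ^ k})"
    using power_mem_span_power[of r z y k] by (auto simp: ideal_radical_def)
qed

lemma primary_ideal_span_power:
  fixes z y :: "'a::comm_ring_1"
  assumes prime_z: "\<And>a b. z dvd a * b \<Longrightarrow> z dvd a \<or> z dvd b" and y: "\<not> z dvd y"
    and prime_zy: "\<And>a b. a * b \<in> ideal.span {z, y} \<Longrightarrow> a \<in> ideal.span {z, y} \<or> b \<in> ideal.span {z, y}"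
    and one: "1 \<notin> ideal.span {z, y}" and k: "k > 0"
  shows "primary_ideal (ideal.span {z, y ^ k})"
proof -
  have rad: "ideal_radical (ideal.span {z, y ^ k}) = ideal.span {z, y}"
    using prime_zy one k by (rule ideal_radical_span_power)
  show ?thesis
    unfolding primary_ideal_def rad
  proof (intro conjI allI impI)
    show "ideal.subspace (ideal.span {z, y ^ k})" by (rule ideal.subspace_span)
    have "1 \<notin> ideal_radical (ideal.span {z, y ^ k})"
      using one rad by simp
    then show "ideal.span {z, y ^ k} \<noteq> UNIV" by (auto simp: ideal_radical_def)
    show "a \<in> ideal.span {z, y ^ k} \<or> b \<in> ideal.span {z, y}" if "a * b \<in> ideal.span {z, y ^ k}" for a b
      using cancel_mod_power[OF prime_z y prime_zy _ that] by (metis (no_types))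
  qed
qed

section \<open>Directional derivatives\<close>

text \<open>The direction is a vector, so that \<open>form_deriv l\<close> (direction
  \<open>coeff_vec l\<close>) and the partial derivatives (directions \<open>axis i 1\<close>) are
  treated alike.\<close>

definition dir_deriv :: "'k ^ 'v \<Rightarrow> ('k::comm_ring_1, 'v::finite) mpoly \<Rightarrow> ('k, 'v) mpoly" where
  "dir_deriv b f = (\<Sum>i\<in>UNIV. const_mpoly (b $ i) * partial_deriv i f)"

lemma form_deriv_eq: "form_deriv l f = dir_deriv (coeff_vec l) f"
  by (simp add: form_deriv_def dir_deriv_def)

lemma partial_deriv_superset:
  assumes "finite S" "Poly_Mapping.keys p \<subseteq> S"
  shows "partial_deriv i p = (\<Sum>m\<in>S. Poly_Mapping.single (m - Poly_Mapping.single i 1)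
        (of_nat (Poly_Mapping.lookup m i) * Poly_Mapping.lookup p m))"
  unfolding partial_deriv_def
  by (rule sum.mono_neutral_left) (use assms in \<open>auto simp: in_keys_iff\<close>)

lemma partial_deriv_add: "partial_deriv i (p + q) = partial_deriv i p + partial_deriv i q"
proof -
  let ?S = "Poly_Mapping.keys p \<union> Poly_Mapping.keys q"
  have "Poly_Mapping.keys (p + q) \<subseteq> ?S" by (rule keys_add)
  then show ?thesis
    by (simp add: partial_deriv_superset[of ?S] lookup_add distrib_left sum.distrib single_add)
qed

lemma partial_deriv_single:
  "partial_deriv i (Poly_Mapping.single m c) =
     Poly_Mapping.single (m - Poly_Mapping.single i 1) (of_nat (Poly_Mapping.lookup m i) * c)"
  by (subst partial_deriv_superset[of "{m}"]) auto

lemma partial_deriv_mult: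
  fixes p q :: "('k::comm_ring_1, 'v::finite) mpoly"
  shows "partial_deriv i (p * q) = partial_deriv i p * q + p * partial_deriv i q"
proof (induction p rule: mpoly_induct)
  case (monom m c)
  show ?case
  proof (induction q rule: mpoly_induct)
    case (monom n d)
    \<comment> \<open>Subtraction of exponents truncates, so the two exponent vectors agree only if
      \<open>i\<close> occurs in \<open>m\<close>; otherwise the coefficient is 0 and both sides
      vanish.\<close>
    have m: "Poly_Mapping.single (m + n - Poly_Mapping.single i 1) (of_nat (Poly_Mapping.lookup m i) * c * d)
        = Poly_Mapping.single (m - Poly_Mapping.single i 1 + n) (of_nat (Poly_Mapping.lookup m i) * c * d)"
      for m n :: "'v \<Rightarrow>\<^sub>0 nat" and c d :: 'k
    proof (cases "Poly_Mapping.lookup m i = 0")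
      case False
      then have "m + n - Poly_Mapping.single i 1 = m - Poly_Mapping.single i 1 + n"
        by (intro poly_mapping_eqI) (auto simp: lookup_minus lookup_add lookup_single when_def)
      then show ?thesis by simp
    qed simp
    show ?case
      using m[of m n c d] m[of n m d c]
      by (simp add: mult_single partial_deriv_single lookup_add distrib_left distrib_right single_add ac_simps)
  next
    case (add q1 q2)
    then show ?case by (simp add: distrib_left partial_deriv_add add_ac)
  qed
next
  case (add p1 p2)
  then show ?case by (simp add: distrib_right partial_deriv_add add_ac)
qed

lemma dir_deriv_mult: "dir_deriv b (p * q) = dir_deriv b p * q + p * dir_deriv b q"
  by (simp add: dir_deriv_def partial_deriv_mult sum_distrib_left sum_distrib_right
      flip: sum.distrib) (simp add: algebra_simps)

lemma dir_deriv_1: "dir_deriv b 1 = 0"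
  using dir_deriv_mult[of b 1 1] by simp

lemma dir_deriv_linear_form:
  fixes p :: "('k::field_char_0, 'v::finite) mpoly"
  assumes "p \<in> linear_forms"
  shows "dir_deriv b p = const_mpoly (eval_mpoly p b)"
proof -
  have 0: "partial_deriv i 0 = 0" for i by (simp add: partial_deriv_def)
  have sum: "partial_deriv i (\<Sum>j\<in>J. f j) = (\<Sum>j\<in>J. partial_deriv i (f j))" for i J and f :: "'v \<Rightarrow> ('k, 'v) mpoly"
    by (induction J rule: infinite_finite_induct) (simp_all add: 0 partial_deriv_add)
  have "partial_deriv i p = const_mpoly (coeff_vec p $ i)" for i
  proof -
    have "partial_deriv i p = (\<Sum>j\<in>UNIV. if j = i then const_mpoly (coeff_vec p $ j) else 0)"
      by (subst linear_form_expand[OF assms], unfold sum, rule sum.cong)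
        (auto simp: partial_deriv_single lookup_single when_def)
    then show ?thesis by simp
  qed
  then show ?thesis
    by (intro mpoly_eqI) (simp add: dir_deriv_def eval_mpoly_sum eval_linear_form[OF assms] mult.commute)
qed

lemma dir_deriv_prod:
  fixes f :: "'i \<Rightarrow> ('k::field_char_0, 'v::finite) mpoly"
  assumes "finite T" "\<And>x. x \<in> T \<Longrightarrow> f x \<in> linear_forms"
  shows "dir_deriv b (\<Prod>x\<in>T. f x) = (\<Sum>x\<in>T. const_mpoly (eval_mpoly (f x) b) * (\<Prod>y\<in>T - {x}. f y))"
  using assms
proof (induction T rule: finite_induct)
  case (insert x T)
  have "(\<Prod>y\<in>insert x T - {x'}. f y) = f x * (\<Prod>y\<in>T - {x'}. f y)" if "x' \<in> T" for x'
  proof -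
    have "insert x T - {x'} = insert x (T - {x'})" using insert.hyps that by auto
    then show ?thesis using insert.hyps by simp
  qed
  moreover have "insert x T - {x} = T" using insert.hyps by auto
  ultimately show ?case using insert
    by (simp add: dir_deriv_mult dir_deriv_linear_form sum_distrib_left mult_ac)
qed (simp add: dir_deriv_1)

lemma dir_deriv_axis: "dir_deriv (axis i 1) f = partial_deriv i f"
proof -
  have "dir_deriv (axis i 1) f = (\<Sum>j\<in>UNIV. if j = i then partial_deriv j f else 0)"
    unfolding dir_deriv_def by (intro sum.cong) (auto simp: axis_def)
  then show ?thesis by simp
qed

section \<open>Arrangements and a direction transversal to all hyperplanes\<close>

lemma const_mpoly_mult: "const_mpoly (c * d) = const_mpoly c * const_mpoly d"
  by (simp add: mult_single)

lemma const_mpoly_prod: "const_mpoly (\<Prod>x\<in>T. c x) = (\<Prod>x\<in>T. const_mpoly (c x))"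
  by (induction T rule: infinite_finite_induct) (simp_all add: const_mpoly_mult)

lemma dir_deriv_const_mult: "dir_deriv b (const_mpoly c * p) = const_mpoly c * dir_deriv b p"
  by (simp add: dir_deriv_mult) (simp add: dir_deriv_def partial_deriv_single)

lemma dvd_prod_diff:
  fixes z :: "'a::comm_ring_1"
  assumes "\<And>x. x \<in> T \<Longrightarrow> z dvd f x - g x"
  shows "z dvd (\<Prod>x\<in>T. f x) - (\<Prod>x\<in>T. g x)"
  using assms
proof (induction T rule: infinite_finite_induct)
  case (insert x T)
  have "z dvd (f x - g x) * prod f T + g x * (prod f T - prod g T)"
    using insert by (intro dvd_add dvd_mult dvd_mult2) auto
  also have "\<dots> = prod f (insert x T) - prod g (insert x T)"
    using insert.hyps by (simp add: algebra_simps)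
  finally show ?case .
qed simp_all

lemma linear_form_dvd_prodD:
  fixes z :: "('k::field_char_0, 'v::finite) mpoly"
  assumes "z \<in> linear_forms" "z \<noteq> 0" "finite T" "z dvd (\<Prod>x\<in>T. f x)"
  shows "\<exists>x\<in>T. z dvd f x"
  using vanishes_on_prodD[OF subspace_linear_form_kernel assms(3)] assms
  by (simp add: linear_form_dvd_iff)

locale arrangement_direction =
  fixes A :: "('k::field_char_0 ^ 'v::finite) set set"
    and \<alpha> :: "('k ^ 'v) set \<Rightarrow> ('k, 'v) mpoly"
    and a :: "'k ^ 'v"
  assumes finite_A: "finite A"
    and form: "H \<in> A \<Longrightarrow> defines_hyperplane (\<alpha> H) H"
    and transversal: "H \<in> A \<Longrightarrow> a \<notin> H"
begin

text \<open>The common value 1 at \<open>a\<close> makes every difference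
  \<open>\<beta> H' - \<beta> H\<close> vanish at \<open>a\<close>, so it is a form for the join of
  the intersection with \<open>a\<close>.\<close>

definition \<beta> :: "('k ^ 'v) set \<Rightarrow> ('k, 'v) mpoly" where
  "\<beta> H = const_mpoly (1 / eval_mpoly (\<alpha> H) a) * \<alpha> H"

lemma mem_iff: "H \<in> A \<Longrightarrow> v \<in> H \<longleftrightarrow> eval_mpoly (\<alpha> H) v = 0"
  using form[of H] unfolding defines_hyperplane_def by blast

lemma \<alpha>_linear [simp]: "H \<in> A \<Longrightarrow> \<alpha> H \<in> linear_forms"
  using form[of H] unfolding defines_hyperplane_def by blast

lemma \<alpha>_at [simp]: "H \<in> A \<Longrightarrow> eval_mpoly (\<alpha> H) a \<noteq> 0"
  using transversal mem_iff by blast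

lemma \<beta>_linear [simp]: "H \<in> A \<Longrightarrow> \<beta> H \<in> linear_forms"
  by (simp add: \<beta>_def linear_forms_const_mult)

lemma \<beta>_at [simp]: "H \<in> A \<Longrightarrow> eval_mpoly (\<beta> H) a = 1"
  by (simp add: \<beta>_def)

lemma \<beta>_nonzero [simp]: "H \<in> A \<Longrightarrow> \<beta> H \<noteq> 0"
  by (metis \<beta>_at eval_mpoly_0 zero_neq_one)

lemma \<beta>_eq_0_iff: "H \<in> A \<Longrightarrow> eval_mpoly (\<beta> H) v = 0 \<longleftrightarrow> v \<in> H"
  using \<alpha>_at[of H] by (simp add: \<beta>_def mem_iff)

lemma \<alpha>_eq: "H \<in> A \<Longrightarrow> \<alpha> H = const_mpoly (eval_mpoly (\<alpha> H) a) * \<beta> H"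
  by (simp add: \<beta>_def mult.assoc[symmetric] mult_single)

lemma \<beta>_inj: "H \<in> A \<Longrightarrow> H' \<in> A \<Longrightarrow> \<beta> H = \<beta> H' \<Longrightarrow> H = H'"
  using \<beta>_eq_0_iff[of H] \<beta>_eq_0_iff[of H'] by auto

lemma \<beta>_dvd_iff: "H \<in> A \<Longrightarrow> \<beta> H dvd p \<longleftrightarrow> (\<forall>v\<in>H. eval_mpoly p v = 0)"
  by (simp add: linear_form_dvd_iff vanishes_on_def \<beta>_eq_0_iff)

lemma \<beta>_prime: "H \<in> A \<Longrightarrow> \<beta> H dvd p * q \<Longrightarrow> \<beta> H dvd p \<or> \<beta> H dvd q"
  by (rule linear_form_prime) simp_all

lemma \<beta>_dvd_linear_form:
  assumes "H \<in> A" "q \<in> linear_forms" "\<beta> H dvd q"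
  shows "q = const_mpoly (eval_mpoly q a) * \<beta> H"
proof -
  obtain k where k: "q = const_mpoly k * \<beta> H"
    using linear_form_proportional[of "\<beta> H" q] assms by (auto simp: \<beta>_dvd_iff \<beta>_eq_0_iff)
  then have "eval_mpoly q a = k" using assms by simp
  then show ?thesis using k by (simp only:)
qed

lemma \<beta>_not_dvd: "H \<in> A \<Longrightarrow> H' \<in> A \<Longrightarrow> H \<noteq> H' \<Longrightarrow> \<not> \<beta> H dvd \<beta> H'"
  using \<beta>_dvd_linear_form[of H "\<beta> H'"] \<beta>_inj[of H H'] by auto

lemma \<beta>_not_dvd_prod:
  assumes "H \<in> A" "F \<subseteq> A" "H \<notin> F"
  shows "\<not> \<beta> H dvd (\<Prod>H'\<in>F. \<beta> H')"
proof
  assume *: "\<beta> H dvd (\<Prod>H'\<in>F. \<beta> H')"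
  have "finite F" using assms finite_A finite_subset by blast
  from linear_form_dvd_prodD[OF _ _ this *] obtain H' where "H' \<in> F" "\<beta> H dvd \<beta> H'"
    using assms by auto
  then show False using \<beta>_not_dvd assms by blast
qed

text \<open>The forms \<open>\<beta> H\<close> are pairwise non-associated primes, so they can be
  split off one after another.\<close>

lemma prod_\<beta>_dvd:
  assumes "F \<subseteq> A" "\<And>H. H \<in> F \<Longrightarrow> \<beta> H dvd x"
  shows "(\<Prod>H\<in>F. \<beta> H) dvd x"
proof -
  have "finite F" using assms finite_A finite_subset by blast
  then show ?thesis using assms
  proof (induction F rule: finite_induct)
    case (insert H F)
    then obtain s where s: "x = (\<Prod>H\<in>F. \<beta> H) * s" by (metis dvdE insert_subset insertI2)
    have "\<beta> H dvd (\<Prod>H\<in>F. \<beta> H) * s" using insert.prems s by auto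
    then have "\<beta> H dvd s"
      using \<beta>_prime[of H "\<Prod>H\<in>F. \<beta> H" s] \<beta>_not_dvd_prod[of H F] insert.hyps insert.prems(1) by auto
    then show ?case using insert.hyps s by (auto simp: mult_ac elim!: dvdE)
  qed simp
qed

section \<open>The residual as an interpolation condition on the hyperplanes\<close>

definition interpolable :: "('k, 'v) mpoly \<Rightarrow> 'k ^ 'v \<Rightarrow> ('k ^ 'v) set set \<Rightarrow> bool" where
  "interpolable g b C \<longleftrightarrow> (\<exists>u. \<forall>H\<in>C. \<beta> H dvd const_mpoly (eval_mpoly (\<beta> H) b) * g - u)"

lemma residual_iff:
  assumes l: "a = coeff_vec l"
  shows "g \<in> residual \<alpha> A l \<longleftrightarrow> (\<forall>b. interpolable g b A)"
proof -
  define p where "p = (\<Prod>H\<in>A. \<beta> H)"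
  define S where "S b = (\<Sum>H\<in>A. const_mpoly (eval_mpoly (\<beta> H) b) * (\<Prod>H'\<in>A - {H}. \<beta> H'))" for b
  define \<kappa> where "\<kappa> = (\<Prod>H\<in>A. eval_mpoly (\<alpha> H) a)"
  define f where "f = arr_poly \<alpha> A"
  have \<kappa>: "\<kappa> \<noteq> 0" using finite_A by (simp add: \<kappa>_def)
  have unit: "const_mpoly (1 / \<kappa>) * const_mpoly \<kappa> = (1 :: ('k, 'v) mpoly)"
    using \<kappa> by (simp add: mult_single)
  have f: "f = const_mpoly \<kappa> * p"
    unfolding f_def arr_poly_def p_def \<kappa>_def const_mpoly_prod prod.distrib[symmetric]
    by (intro prod.cong \<alpha>_eq refl)
  have D: "dir_deriv b f = const_mpoly \<kappa> * S b" for b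
    unfolding f dir_deriv_const_mult p_def S_def using finite_A by (simp add: dir_deriv_prod)
  have p_eq: "\<beta> H * (\<Prod>H'\<in>A - {H}. \<beta> H') = p" if "H \<in> A" for H
    using that finite_A by (simp add: p_def prod.remove)
  \<comment> \<open>\<open>S b\<close> is the derivative of \<open>p\<close> in direction
    \<open>b\<close>, and all scalars in \<open>S a\<close> are 1. In the resulting sum
    \<open>\<beta> H\<close> divides every term except possibly that of \<open>H\<close>, so
    divisibility by \<open>p\<close> decouples into one congruence per hyperplane.\<close>
  have diff: "g * S b - u * S a =
      (\<Sum>H\<in>A. (const_mpoly (eval_mpoly (\<beta> H) b) * g - u) * (\<Prod>H'\<in>A - {H}. \<beta> H'))" for u b
  proof -
    have "S a = (\<Sum>H\<in>A. \<Prod>H'\<in>A - {H}. \<beta> H')" unfolding S_def by (intro sum.cong) auto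
    then show ?thesis
      by (simp add: S_def sum_distrib_left algebra_simps sum_subtractf)
  qed
  have I: "ideal.span {f, form_deriv l f} = {x. \<exists>r u. x = r * f + u * dir_deriv a f}"
    by (auto simp: ideal.span_insert ideal.span_singleton form_deriv_eq l algebra_simps)
  show ?thesis
  proof (intro iffI allI)
    fix b assume "g \<in> residual \<alpha> A l"
    moreover have "dir_deriv b f \<in> jacobian_ideal f"
      unfolding dir_deriv_def jacobian_ideal_def
      by (intro ideal.span_sum ideal.span_scale ideal.span_base) auto
    ultimately have "g * dir_deriv b f \<in> ideal.span {f, form_deriv l f}"
      unfolding residual_def colon_ideal_def f_def by blast
    then obtain r u where ru: "g * dir_deriv b f = r * f + u * dir_deriv a f"
      unfolding I by blast
    have "const_mpoly \<kappa> * (g * S b) = const_mpoly \<kappa> * (r * p + u * S a)"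
      using ru unfolding D unfolding f by (simp add: algebra_simps)
    then have "g * S b - u * S a = r * p"
      by (metis (no_types, opaque_lifting) add_diff_cancel_right' mult.assoc mult_1 unit)
    have "\<beta> H dvd const_mpoly (eval_mpoly (\<beta> H) b) * g - u" if H: "H \<in> A" for H
    proof -
      let ?t = "\<lambda>H. (const_mpoly (eval_mpoly (\<beta> H) b) * g - u) * (\<Prod>H'\<in>A - {H}. \<beta> H')"
      have "r * p = ?t H + (\<Sum>H'\<in>A - {H}. ?t H')"
        using diff[of b u] \<open>g * S b - u * S a = r * p\<close> H finite_A by (simp add: sum.remove)
      then have t: "?t H = r * p - (\<Sum>H'\<in>A - {H}. ?t H')" by simp
      have 1: "\<beta> H dvd r * p" by (simp flip: p_eq[OF H])
      have 2: "\<beta> H dvd (\<Sum>H'\<in>A - {H}. ?t H')"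
        using H finite_A by (intro dvd_sum dvd_mult) (auto intro: dvd_prodI)
      have "\<beta> H dvd ?t H" unfolding t by (rule dvd_diff[OF 1 2])
      then show ?thesis using \<beta>_prime \<beta>_not_dvd_prod H by (meson DiffD2 Diff_subset singletonI)
    qed
    then show "interpolable g b A" unfolding interpolable_def by blast
  next
    assume *: "\<forall>b. interpolable g b A"
    have gen: "g * dir_deriv b f \<in> ideal.span {f, form_deriv l f}" for b
    proof -
      obtain u where u: "\<And>H. H \<in> A \<Longrightarrow> \<beta> H dvd const_mpoly (eval_mpoly (\<beta> H) b) * g - u"
        using * unfolding interpolable_def by blast
      have "p dvd g * S b - u * S a"
        unfolding diff
      proof (rule dvd_sum)
        fix H assume H: "H \<in> A"
        show "p dvd (const_mpoly (eval_mpoly (\<beta> H) b) * g - u) * (\<Prod>H'\<in>A - {H}. \<beta> H')"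
          unfolding p_eq[OF H, symmetric] using u[OF H] by (intro mult_dvd_mono) auto
      qed
      then obtain r where "g * S b - u * S a = p * r" by blast
      then have "g * S b = r * p + u * S a" by (simp add: algebra_simps)
      have "g * dir_deriv b f = const_mpoly \<kappa> * (g * S b)" by (simp add: D mult_ac)
      also have "\<dots> = r * f + u * dir_deriv a f"
        unfolding \<open>g * S b = _\<close> D unfolding f by (simp add: algebra_simps)
      finally show ?thesis unfolding I by blast
    qed
    \<comment> \<open>The multipliers \<open>s\<close> form an ideal, so it suffices to test the
      partial derivatives that generate the Jacobian ideal.\<close>
    have "ideal.subspace {s. g * s \<in> ideal.span {f, form_deriv l f}}"
      unfolding ideal.subspace_def
      by (auto simp: distrib_left mult.left_commute intro: ideal.span_zero ideal.span_add ideal.span_scale)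
    moreover have "range (\<lambda>i. partial_deriv i f) \<subseteq> {s. g * s \<in> ideal.span {f, form_deriv l f}}"
      using gen by (auto simp flip: dir_deriv_axis)
    ultimately have "jacobian_ideal f \<subseteq> {s. g * s \<in> ideal.span {f, form_deriv l f}}"
      unfolding jacobian_ideal_def by (rule ideal.span_minimal[rotated])
    then show "g \<in> residual \<alpha> A l"
      unfolding residual_def colon_ideal_def f_def by blast
  qed
qed

section \<open>Hyperplanes of one pencil and interpolation on them\<close>

lemma join_not_dvd:
  assumes z: "z \<in> linear_forms" "z \<noteq> 0" "eval_mpoly z a = 0" and H: "H \<in> A"
  shows "\<not> z dvd \<beta> H" "\<not> \<beta> H dvd z"
proof -
  show "\<not> z dvd \<beta> H" using z H by (auto simp: linear_form_dvd_iff vanishes_on_def intro!: exI[of _ a])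
  show "\<not> \<beta> H dvd z" using \<beta>_dvd_linear_form[OF H z(1)] z by auto
qed

text \<open>From a zero \<open>v\<close> of \<open>z\<close>, subtract the multiple of
  \<open>a\<close> that makes \<open>\<beta> H0\<close> vanish; the result is still a zero of
  \<open>z\<close>. If \<open>\<beta> H\<close> vanishes there too, then \<open>\<beta> H\<close>
  and \<open>\<beta> H0\<close> agree at \<open>v\<close>, both being 1 at \<open>a\<close>. The
  second form exhibits the pencil \<open>y - t z\<close>.\<close>

lemma join_dvd_iff:
  assumes z: "z \<in> linear_forms" "z \<noteq> 0" "eval_mpoly z a = 0" and H: "H \<in> A" "H0 \<in> A"
  shows "z dvd \<beta> H0 - \<beta> H \<longleftrightarrow> \<beta> H \<in> ideal.span {z, \<beta> H0}"
    and "z dvd \<beta> H0 - \<beta> H \<longleftrightarrow> (\<exists>t. \<beta> H = \<beta> H0 - const_mpoly t * z)"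
proof -
  show "z dvd \<beta> H0 - \<beta> H \<longleftrightarrow> \<beta> H \<in> ideal.span {z, \<beta> H0}"
  proof
    assume "z dvd \<beta> H0 - \<beta> H"
    then have "z dvd \<beta> H - 1 * \<beta> H0" using dvd_minus_iff[of z "\<beta> H0 - \<beta> H"] by simp
    then show "\<beta> H \<in> ideal.span {z, \<beta> H0}" unfolding mem_ideal_span2_iff by blast
  next
    assume "\<beta> H \<in> ideal.span {z, \<beta> H0}"
    then have van: "vanishes_on (\<beta> H) {v. eval_mpoly z v = 0 \<and> eval_mpoly (\<beta> H0) v = 0}"
      using z H join_not_dvd[OF z H(2)] by (simp add: mem_ideal_span_linear_forms_iff)
    have "eval_mpoly (\<beta> H0 - \<beta> H) v = 0" if v: "eval_mpoly z v = 0" for v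
    proof -
      let ?w = "v - eval_mpoly (\<beta> H0) v *s a"
      have "eval_mpoly z ?w = 0" "eval_mpoly (\<beta> H0) ?w = 0" using z H v by simp_all
      then have "eval_mpoly (\<beta> H) ?w = 0" using van by (simp add: vanishes_on_def)
      then show ?thesis using H by simp
    qed
    then show "z dvd \<beta> H0 - \<beta> H" using z by (simp add: linear_form_dvd_iff vanishes_on_def)
  qed
  show "z dvd \<beta> H0 - \<beta> H \<longleftrightarrow> (\<exists>t. \<beta> H = \<beta> H0 - const_mpoly t * z)"
  proof
    assume "z dvd \<beta> H0 - \<beta> H"
    then obtain k where "\<beta> H0 - \<beta> H = const_mpoly k * z"
      using linear_form_proportional[of z "\<beta> H0 - \<beta> H"] z H
      by (auto simp: linear_form_dvd_iff vanishes_on_def linear_forms_diff)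
    then have "\<beta> H = \<beta> H0 - const_mpoly k * z" by (simp add: algebra_simps)
    then show "\<exists>t. \<beta> H = \<beta> H0 - const_mpoly t * z" ..
  qed auto
qed

lemma local_prod:
  assumes "\<And>H. H \<in> C \<Longrightarrow> z dvd \<beta> H0 - \<beta> H"
  shows "z dvd \<beta> H0 ^ card C - (\<Prod>H\<in>C. \<beta> H)"
  using dvd_prod_diff[of C z "\<lambda>_. \<beta> H0" \<beta>] assms by simp

lemma local_interpolation_necessary:
  assumes z: "z \<in> linear_forms" "z \<noteq> 0" "eval_mpoly z a = 0"
    and C: "C \<subseteq> A" "H0 \<in> C" "\<And>H. H \<in> C \<Longrightarrow> z dvd \<beta> H0 - \<beta> H"
    and g: "\<And>b. interpolable g b C"
  shows "g \<in> ideal.span {z, \<beta> H0 ^ (card C - 1)}"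
proof -
  let ?y = "\<beta> H0"
  have H0: "H0 \<in> A" using C by blast
  have "finite C" using C(1) finite_A finite_subset by blast
  then have card: "card C > 0" using C(2) by (auto simp: card_gt_0_iff)
  \<comment> \<open>Scaling \<open>b0\<close> and subtracting a multiple of \<open>a\<close>, where
    \<open>z\<close> is 0, yields a direction \<open>b\<close> in which the datum of
    \<open>\<beta> H = y - t z\<close> is exactly its parameter \<open>t\<close>.\<close>
  obtain b0 where b0: "eval_mpoly z b0 \<noteq> 0" using z eval_mpoly_eq_0D by blast
  define b1 where "b1 = (- 1 / eval_mpoly z b0) *s b0"
  define b where "b = b1 - eval_mpoly ?y b1 *s a"
  have b: "eval_mpoly z b = - 1" "eval_mpoly ?y b = 0"
    unfolding b_def using z H0 b0 by (simp_all add: b1_def)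
  obtain u where u: "\<And>H. H \<in> C \<Longrightarrow> \<beta> H dvd const_mpoly (eval_mpoly (\<beta> H) b) * g - u"
    using g[of b] unfolding interpolable_def by blast
  have "(\<Prod>H\<in>C. \<beta> H) dvd ?y * g - z * u"
  proof (rule prod_\<beta>_dvd[OF C(1)])
    fix H assume H: "H \<in> C"
    then obtain t where t: "\<beta> H = ?y - const_mpoly t * z"
      using join_dvd_iff(2)[OF z _ H0] C by blast
    have "eval_mpoly (\<beta> H) b = t" by (simp add: t b)
    then have "\<beta> H dvd const_mpoly t * g - u" using u[OF H] by (simp only:)
    then have "\<beta> H dvd \<beta> H * g + z * (const_mpoly t * g - u)"
      by (rule dvd_add[OF dvd_triv_left dvd_mult])
    also have "\<beta> H * g + z * (const_mpoly t * g - u) = ?y * g - z * u"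
      by (simp add: t algebra_simps)
    finally show "\<beta> H dvd ?y * g - z * u" .
  qed
  then obtain s where s: "?y * g - z * u = (\<Prod>H\<in>C. \<beta> H) * s" by blast
  \<comment> \<open>Modulo \<open>z\<close> the product over \<open>C\<close> becomes a power of
    \<open>y\<close>. Then one factor \<open>y\<close> cancels because \<open>z\<close> is prime and
    does not divide \<open>y\<close>, which lowers the exponent to
    \<open>card C - 1\<close>.\<close>
  have "z dvd z * u - (?y ^ card C - (\<Prod>H\<in>C. \<beta> H)) * s"
    by (rule dvd_diff[OF dvd_triv_left dvd_mult2[OF local_prod[OF C(3)]]])
  also have "\<dots> = ?y * g - ?y ^ card C * s"
    using s by (simp add: algebra_simps)
  also have "\<dots> = ?y * (g - s * ?y ^ (card C - 1))"
    using card by (simp add: algebra_simps flip: power_Suc)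
  finally have "z dvd g - s * ?y ^ (card C - 1)"
    using linear_form_prime z join_not_dvd[OF z H0] by blast
  then show ?thesis by (auto simp: mem_ideal_span2_iff)
qed

lemma local_interpolation_sufficient:
  assumes z: "z \<in> linear_forms" "z \<noteq> 0" "eval_mpoly z a = 0"
    and C: "C \<subseteq> A" "H0 \<in> C" "\<And>H. H \<in> C \<Longrightarrow> z dvd \<beta> H0 - \<beta> H"
    and g: "g \<in> ideal.span {z, \<beta> H0 ^ (card C - 1)}"
  shows "interpolable g b C"
proof -
  let ?y = "\<beta> H0" and ?k = "card C - 1"
  have H0: "H0 \<in> A" using C by blast
  have "finite C" using C(1) finite_A finite_subset by blast
  then have card: "card C > 0" using C(2) by (auto simp: card_gt_0_iff)
  obtain w where w: "?y ^ card C - (\<Prod>H\<in>C. \<beta> H) = z * w"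
    using local_prod[OF C(3)] by blast
  obtain s r where "g - s * ?y ^ ?k = z * r" using g by (auto simp: mem_ideal_span2_iff)
  then have g_eq: "g = z * r + s * ?y ^ ?k" by (simp add: algebra_simps)
  \<comment> \<open>On \<open>H\<close> one has \<open>y = t z\<close>, hence
    \<open>w = t y^(m-1)\<close> with \<open>m = card C\<close>, and \<open>u1\<close> restricts to
    \<open>t (z r + s y^(m-1)) = t g\<close>. So \<open>u1\<close> interpolates the data
    \<open>t g\<close>.\<close>
  define u1 where "u1 = ?y * r + w * s"
  have "\<beta> H dvd const_mpoly (eval_mpoly (\<beta> H) b) * g -
      (const_mpoly (eval_mpoly ?y b) * g - const_mpoly (eval_mpoly z b) * u1)" if H: "H \<in> C" for H
  proof -
    have HA: "H \<in> A" using H C by blast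
    then obtain t where t: "\<beta> H = ?y - const_mpoly t * z"
      using join_dvd_iff(2)[OF z _ H0] C H by blast
    have "\<beta> H dvd (\<Prod>H\<in>C. \<beta> H) - \<beta> H * ?y ^ ?k"
      using H \<open>finite C\<close> by (intro dvd_diff dvd_prodI) auto
    also have "(\<Prod>H\<in>C. \<beta> H) - \<beta> H * ?y ^ ?k = ?y ^ card C - z * w - \<beta> H * ?y ^ ?k"
      by (simp flip: w)
    also have "\<dots> = z * (const_mpoly t * ?y ^ ?k - w)"
      using card by (simp add: t algebra_simps flip: power_Suc)
    finally have "\<beta> H dvd const_mpoly t * ?y ^ ?k - w"
      using \<beta>_prime HA join_not_dvd[OF z HA] by blast
    then have "\<beta> H dvd (const_mpoly t * ?y ^ ?k - w) * s - \<beta> H * r"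
      by (rule dvd_diff[OF dvd_mult2 dvd_mult2[OF dvd_refl]])
    also have "\<dots> = const_mpoly t * g - u1"
      by (simp add: g_eq u1_def t algebra_simps)
    \<comment> \<open>An arbitrary direction reduces to the data \<open>t g\<close>, since
      \<open>\<beta> H\<close> has value \<open>y(b) - t z(b)\<close> at \<open>b\<close>.\<close>
    finally have "\<beta> H dvd - const_mpoly (eval_mpoly z b) * (const_mpoly t * g - u1)"
      by (rule dvd_mult)
    also have "\<dots> = const_mpoly (eval_mpoly (\<beta> H) b) * g -
      (const_mpoly (eval_mpoly ?y b) * g - const_mpoly (eval_mpoly z b) * u1)"
      by (simp add: t single_diff const_mpoly_mult algebra_simps)
    finally show ?thesis .
  qed
  then show ?thesis unfolding interpolable_def by blast
qed

lemma global_interpolation: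
  assumes loc: "\<And>z H0. z \<in> linear_forms \<Longrightarrow> z \<noteq> 0 \<Longrightarrow> eval_mpoly z a = 0 \<Longrightarrow> H0 \<in> A \<Longrightarrow>
      interpolable g b {H \<in> A. z dvd \<beta> H0 - \<beta> H}"
  shows "interpolable g b A"
proof -
  define c where "c H = const_mpoly (eval_mpoly (\<beta> H) b) * g" for H
  \<comment> \<open>\<open>J s\<close> says that the data multiplied by \<open>s\<close> can be
    interpolated; the goal is \<open>J 1\<close>.\<close>
  define J where "J s \<longleftrightarrow> (\<exists>N. \<forall>H\<in>A. \<beta> H dvd c H * s - N)" for s
  have cancel: "J s" if z: "z \<in> linear_forms" "z \<noteq> 0" "eval_mpoly z a = 0" and J: "J (z * s)" for z s
  proof -
    obtain N where N: "\<And>H. H \<in> A \<Longrightarrow> \<beta> H dvd c H * (z * s) - N" using J unfolding J_def by blast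
    \<comment> \<open>The class of \<open>H0\<close> collects the hyperplanes with the same trace on
      \<open>z = 0\<close>. Distinct classes are disjoint and together they cover
      \<open>A\<close>.\<close>
    define cl where "cl H0 = {H \<in> A. z dvd \<beta> H0 - \<beta> H}" for H0
    have cl: "N \<in> ideal.span {z, \<Prod>H\<in>cl H0. \<beta> H}" if H0: "H0 \<in> A" for H0
    proof -
      obtain u where u: "\<And>H. H \<in> cl H0 \<Longrightarrow> \<beta> H dvd c H - u"
        using loc[OF z H0] unfolding interpolable_def cl_def c_def by blast
      have "(\<Prod>H\<in>cl H0. \<beta> H) dvd z * s * u - N"
      proof (rule prod_\<beta>_dvd)
        fix H assume H: "H \<in> cl H0"
        have "\<beta> H dvd (c H * (z * s) - N) - z * s * (c H - u)"
          by (rule dvd_diff[OF N dvd_mult[OF u]]) (use H in \<open>auto simp: cl_def\<close>)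
        then show "\<beta> H dvd z * s * u - N" by (simp add: algebra_simps)
      qed (auto simp: cl_def)
      then obtain w where "z * s * u - N = (\<Prod>H\<in>cl H0. \<beta> H) * w" by blast
      then have "N - (- w) * (\<Prod>H\<in>cl H0. \<beta> H) = z * (s * u)" by (simp add: algebra_simps)
      then have "z dvd N - (- w) * (\<Prod>H\<in>cl H0. \<beta> H)" by simp
      then show ?thesis unfolding mem_ideal_span2_iff by blast
    qed
    \<comment> \<open>Membership is known class by class; the induction over representatives
      \<open>R\<close> multiplies the classes together modulo \<open>z\<close>.\<close>
    have "N \<in> ideal.span {z, \<Prod>H\<in>(\<Union>H0\<in>R. cl H0). \<beta> H}" if "R \<subseteq> A" for R
    proof -
      have "finite R" using that finite_A finite_subset by blast
      then show ?thesis using that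
      proof (induction R rule: finite_induct)
        case empty
        then show ?case by (auto simp: mem_ideal_span2_iff intro!: exI[of _ N])
      next
        case (insert H0 R)
        let ?B = "\<Union>H0\<in>R. cl H0" and ?y = "\<beta> H0"
        have H0: "H0 \<in> A" and B: "?B \<subseteq> A" using insert.prems by (auto simp: cl_def)
        have IH: "N \<in> ideal.span {z, \<Prod>H\<in>?B. \<beta> H}" using insert by blast
        show ?case
        proof (cases "H0 \<in> ?B")
          case True
          then obtain H1 where H1: "H1 \<in> R" "z dvd \<beta> H1 - \<beta> H0" by (auto simp: cl_def)
          have "cl H0 \<subseteq> cl H1"
          proof
            fix H assume "H \<in> cl H0"
            then have "z dvd (\<beta> H1 - \<beta> H0) + (\<beta> H0 - \<beta> H)" "H \<in> A"
              unfolding cl_def using dvd_add[OF H1(2)] by blast+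
            then show "H \<in> cl H1" by (simp add: cl_def)
          qed
          then have "(\<Union>H0\<in>insert H0 R. cl H0) = ?B" using H1 by blast
          then show ?thesis using IH by simp
        next
          case False
          have disj: "cl H0 \<inter> ?B = {}"
          proof (rule ccontr)
            assume "cl H0 \<inter> ?B \<noteq> {}"
            then obtain H H1 where H: "H1 \<in> R" "z dvd \<beta> H0 - \<beta> H" "z dvd \<beta> H1 - \<beta> H"
              by (auto simp: cl_def)
            have "z dvd (\<beta> H1 - \<beta> H) - (\<beta> H0 - \<beta> H)" by (rule dvd_diff[OF H(3,2)])
            then have "H0 \<in> cl H1" using H0 by (simp add: cl_def)
            then show False using False H by blast
          qed
          have fin: "finite (cl H0)" "finite ?B" using B finite_A by (auto simp: cl_def intro: finite_subset)
          let ?G = "\<Prod>H\<in>?B. \<beta> H"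
          have not_dvd: "\<not> z dvd ?y" using join_not_dvd[OF z H0] by blast
          have prime: "p \<in> ideal.span {z, ?y} \<or> q \<in> ideal.span {z, ?y}"
            if "p * q \<in> ideal.span {z, ?y}" for p q
            using ideal_span_linear_forms_prime[OF z(1,2) _ not_dvd that] H0 by simp
          \<comment> \<open>If the product of the other classes lay in this prime ideal, so would
            one factor \<open>\<beta> H\<close>, and \<open>H\<close> would belong to the class of
            \<open>H0\<close>. Hence \<open>?G\<close> may be cancelled modulo powers of
            \<open>?y\<close>.\<close>
          have G: "?G \<notin> ideal.span {z, ?y}"
          proof
            assume "?G \<in> ideal.span {z, ?y}"
            then have "vanishes_on ?G {v. eval_mpoly z v = 0 \<and> eval_mpoly ?y v = 0}"
              using z H0 not_dvd by (simp only: mem_ideal_span_linear_forms_iff \<beta>_linear not_False_eq_True)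
            moreover have "vec.subspace {v. eval_mpoly z v = 0 \<and> eval_mpoly ?y v = 0}"
              using z H0 by (simp add: vec.subspace_def)
            ultimately obtain H where H: "H \<in> ?B" "vanishes_on (\<beta> H) {v. eval_mpoly z v = 0 \<and> eval_mpoly ?y v = 0}"
              using vanishes_on_prodD[OF _ fin(2)] by blast
            then have "\<beta> H \<in> ideal.span {z, ?y}"
              using z H0 not_dvd by (simp only: mem_ideal_span_linear_forms_iff \<beta>_linear not_False_eq_True)
            moreover have "H \<in> A" using H B by blast
            ultimately have "z dvd ?y - \<beta> H" using join_dvd_iff(1)[OF z _ H0, of H] by (simp only:)
            then have "H \<in> cl H0" using H B by (auto simp: cl_def)
            then show False using disj H by blast
          qed
          have "z dvd (\<Prod>H\<in>cl H0. \<beta> H) - 1 * ?y ^ card (cl H0)"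
            using local_prod[of "cl H0" z H0]
              dvd_minus_iff[of z "?y ^ card (cl H0) - (\<Prod>H\<in>cl H0. \<beta> H)"]
            by (simp add: cl_def)
          then have span: "ideal.span {z, \<Prod>H\<in>cl H0. \<beta> H} = ideal.span {z, ?y ^ card (cl H0)}"
            by (rule ideal_span2_cong[where u = 1]) simp
          obtain q where q: "z dvd N - q * ?G" using IH by (auto simp: mem_ideal_span2_iff)
          obtain q' where q': "z dvd N - q' * ?y ^ card (cl H0)"
            using cl[OF H0] unfolding span by (auto simp: mem_ideal_span2_iff)
          have "z dvd (N - q' * ?y ^ card (cl H0)) - (N - q * ?G)" by (rule dvd_diff[OF q' q])
          \<comment> \<open>Modulo \<open>z\<close>, both \<open>q * ?G\<close> and a multiple of
            \<open>?y ^ card (cl H0)\<close> represent \<open>N\<close>. Cancelling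
            \<open>?G\<close> makes \<open>q\<close> a multiple of the new class product modulo
            \<open>z\<close>.\<close>
          then have "q * ?G \<in> ideal.span {z, ?y ^ card (cl H0)}"
            by (auto simp: mem_ideal_span2_iff)
          then have "q \<in> ideal.span {z, ?y ^ card (cl H0)}"
            using cancel_mod_power[OF linear_form_prime[OF z(1,2)] not_dvd prime G] by blast
          then obtain q'' where q'': "z dvd q - q'' * (\<Prod>H\<in>cl H0. \<beta> H)"
            unfolding span[symmetric] by (auto simp: mem_ideal_span2_iff)
          have "z dvd (N - q * ?G) + (q - q'' * (\<Prod>H\<in>cl H0. \<beta> H)) * ?G"
            using q q'' by (intro dvd_add dvd_mult2)
          also have "\<dots> = N - q'' * ((\<Prod>H\<in>cl H0. \<beta> H) * ?G)" by (simp add: algebra_simps)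
          also have "(\<Prod>H\<in>cl H0. \<beta> H) * ?G = (\<Prod>H\<in>(\<Union>H0\<in>insert H0 R. cl H0). \<beta> H)"
            using fin disj by (simp add: prod.union_disjoint)
          finally show ?thesis by (auto simp: mem_ideal_span2_iff)
        qed
      qed
    qed
    from this[of A] have "N \<in> ideal.span {z, \<Prod>H\<in>(\<Union>H0\<in>A. cl H0). \<beta> H}" by simp
    moreover have "(\<Union>H0\<in>A. cl H0) = A" by (auto simp: cl_def)
    \<comment> \<open>Subtracting a multiple of the full product does not affect the interpolation
      property, and leaves a multiple of \<open>z\<close>. Its quotient \<open>M\<close>
      interpolates the data multiplied by \<open>s\<close>.\<close>
    ultimately obtain q M where M: "N - q * (\<Prod>H\<in>A. \<beta> H) = z * M"
      by (auto simp: mem_ideal_span2_iff)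
    have "\<beta> H dvd c H * s - M" if H: "H \<in> A" for H
    proof -
      have "\<beta> H dvd (c H * (z * s) - N) + q * (\<Prod>H\<in>A. \<beta> H)"
        using H finite_A N by (intro dvd_add dvd_mult dvd_prodI)
      also have "\<dots> = z * (c H * s - M)"
        using M by (simp add: algebra_simps)
      finally show ?thesis using \<beta>_prime[OF H] join_not_dvd[OF z H] by blast
    qed
    then show "J s" unfolding J_def by blast
  qed
  have cancel_prod: "J s" if "finite T" "\<And>x s. x \<in> T \<Longrightarrow> J (f x * s) \<Longrightarrow> J s" "J ((\<Prod>x\<in>T. f x) * s)"
    for T :: "('k ^ 'v) set set" and f s
    using that
  proof (induction T arbitrary: s rule: finite_induct)
    case (insert x T)
    then have "J (f x * (prod f T * s))" by (simp add: mult.assoc)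
    then show ?case using insert.IH insert.prems(1) by (meson insertCI)
  qed simp
  \<comment> \<open>Modulo \<open>\<beta> H\<close>, the factor \<open>D H\<close> equals the
    product of the other forms \<open>\<beta> H'\<close>. The additional factors \<open>D H'\<close>
    in \<open>N\<close> give all hyperplanes the common scalar
    \<open>\<Prod>H\<in>A. D H\<close>.\<close>
  define D where "D H = (\<Prod>H'\<in>A - {H}. \<beta> H' - \<beta> H)" for H
  define N where "N = (\<Sum>H\<in>A. c H * (\<Prod>H'\<in>A - {H}. D H') * (\<Prod>H'\<in>A - {H}. \<beta> H'))"
  have "\<beta> H dvd c H * ((\<Prod>H\<in>A. D H) * 1) - N" if H: "H \<in> A" for H
  proof -
    let ?t = "\<lambda>H. c H * (\<Prod>H'\<in>A - {H}. D H') * (\<Prod>H'\<in>A - {H}. \<beta> H')"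
    have N: "N = ?t H + (\<Sum>H'\<in>A - {H}. ?t H')" using H finite_A by (simp add: N_def sum.remove)
    have "\<beta> H dvd (\<Prod>H'\<in>A - {H}. \<beta> H' - \<beta> H) - (\<Prod>H'\<in>A - {H}. \<beta> H')"
      by (rule dvd_prod_diff) simp
    then have "\<beta> H dvd c H * (\<Prod>H'\<in>A - {H}. D H') * (D H - (\<Prod>H'\<in>A - {H}. \<beta> H'))"
      unfolding D_def[of H] by (rule dvd_mult)
    moreover have "\<beta> H dvd (\<Sum>H'\<in>A - {H}. ?t H')"
      using H finite_A by (intro dvd_sum dvd_mult) (auto intro: dvd_prodI)
    ultimately have "\<beta> H dvd c H * (\<Prod>H'\<in>A - {H}. D H') * (D H - (\<Prod>H'\<in>A - {H}. \<beta> H'))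
        - (\<Sum>H'\<in>A - {H}. ?t H')" by (rule dvd_diff)
    also have "\<dots> = c H * ((\<Prod>H\<in>A. D H) * 1) - N"
      using H finite_A by (simp add: N prod.remove[of A H D] algebra_simps)
    finally show ?thesis .
  qed
  then have "J ((\<Prod>H\<in>A. D H) * 1)" unfolding J_def by blast
  then have "J 1"
  proof (rule cancel_prod[OF finite_A, rotated])
    fix H s assume H: "H \<in> A" and "J (D H * s)"
    show "J s"
    proof (rule cancel_prod[where T = "A - {H}" and f = "\<lambda>H'. \<beta> H' - \<beta> H"])
      show "J ((\<Prod>H'\<in>A - {H}. \<beta> H' - \<beta> H) * s)" using \<open>J (D H * s)\<close> by (simp add: D_def)
      fix H' s assume H': "H' \<in> A - {H}" and J: "J ((\<beta> H' - \<beta> H) * s)"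
      show "J s"
        by (rule cancel[OF _ _ _ J]) (use H H' \<beta>_inj[of H' H] in \<open>auto simp: linear_forms_diff\<close>)
    qed (use finite_A in simp)
  qed
  then show ?thesis unfolding J_def interpolable_def c_def by simp
qed

text \<open>For \<open>P = H1 \<inter> H2\<close> the witness \<open>\<beta> H1 - \<beta> H2\<close>
  vanishes on \<open>P\<close> and at \<open>a\<close>. Any zero \<open>v\<close> of it lies in
  their span, because subtracting \<open>\<beta> H1\<close> at \<open>v\<close> times
  \<open>a\<close> moves \<open>v\<close> into \<open>P\<close>.\<close>

lemma join_exists:
  assumes l: "a = coeff_vec l" and P: "P \<in> codim2_intersections A"
  shows "\<exists>h. defines_join h P l"
proof -
  obtain H1 H2 where H: "H1 \<in> A" "H2 \<in> A" "H1 \<noteq> H2" "P = H1 \<inter> H2"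
    using P by (auto simp: codim2_intersections_def)
  define h where "h = \<beta> H1 - \<beta> H2"
  have lin: "h \<in> linear_forms" using H by (simp add: h_def linear_forms_diff)
  have van: "eval_mpoly (\<beta> H1) v = 0" "eval_mpoly (\<beta> H2) v = 0" if "v \<in> P" for v
    using that H by (simp_all add: \<beta>_eq_0_iff)
  have "h \<noteq> 0" using \<beta>_inj[of H1 H2] H by (auto simp: h_def)
  moreover have "vec.span (P \<union> {a}) \<subseteq> {v. eval_mpoly h v = 0}"
    using van H by (intro vec.span_minimal subspace_linear_form_kernel lin) (auto simp: h_def)
  moreover have "v \<in> vec.span (P \<union> {a})" if "eval_mpoly h v = 0" for v
  proof -
    let ?w = "v - eval_mpoly (\<beta> H1) v *s a"
    have "?w \<in> P"
      using that H \<beta>_eq_0_iff[of H1 ?w] \<beta>_eq_0_iff[of H2 ?w] by (simp add: h_def)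
    then have "?w + eval_mpoly (\<beta> H1) v *s a \<in> vec.span (P \<union> {a})"
      by (intro vec.span_add vec.span_scale vec.span_base) auto
    then show ?thesis by simp
  qed
  ultimately have "defines_join h P l"
    using lin unfolding defines_join_def defines_hyperplane_def l by blast
  then show ?thesis ..
qed

end

section \<open>The primary components\<close>

lemma minimal_primary_decomposition_cong:
  assumes "\<And>P. P \<in> T \<Longrightarrow> Q P = Q' P"
  shows "minimal_primary_decomposition I T Q \<longleftrightarrow> minimal_primary_decomposition I T Q'"
proof -
  have "inj_on (\<lambda>P. ideal_radical (Q P)) T \<longleftrightarrow> inj_on (\<lambda>P. ideal_radical (Q' P)) T"
    using assms by (intro inj_on_cong) simp
  then show ?thesis
    unfolding minimal_primary_decomposition_def using assms by simp
qed

locale arrangement_joins = arrangement_direction A \<alpha> "coeff_vec l"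
  for A :: "('k::field_char_0 ^ 'v::finite) set set" and \<alpha> and l :: "('k, 'v) mpoly" +
  fixes h :: "('k ^ 'v) set \<Rightarrow> ('k, 'v) mpoly"
  assumes join: "P \<in> codim2_intersections A \<Longrightarrow> defines_join (h P) P l"
begin

definition cluster :: "('k ^ 'v) set \<Rightarrow> ('k ^ 'v) set set" where
  "cluster P = {H \<in> A. P \<subseteq> H}"

text \<open>The choice is harmless: by \<open>cluster_dvd\<close> all forms of a cluster agree
  modulo \<open>h P\<close>.\<close>

definition component_form :: "('k ^ 'v) set \<Rightarrow> ('k, 'v) mpoly" where
  "component_form P = \<beta> (SOME H. H \<in> cluster P)"

definition component_exp :: "('k ^ 'v) set \<Rightarrow> nat" where
  "component_exp P = card (cluster P) - 1"

text \<open>Common normal form to which both descriptions of the primary component are reduced; the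
  exponent is the number of hyperplanes through \<open>P\<close> minus 1.\<close>

definition component :: "('k ^ 'v) set \<Rightarrow> ('k, 'v) mpoly set" where
  "component P = ideal.span {h P, component_form P ^ component_exp P}"

lemma cluster_subset: "cluster P \<subseteq> A" and finite_cluster [simp]: "finite (cluster P)"
  using finite_A by (auto simp: cluster_def)

lemma
  assumes P: "P \<in> codim2_intersections A"
  shows h_linear [simp]: "h P \<in> linear_forms" and h_nonzero [simp]: "h P \<noteq> 0"
    and h_kernel: "eval_mpoly (h P) v = 0 \<longleftrightarrow> v \<in> vec.span (P \<union> {coeff_vec l})"
    and h_at [simp]: "eval_mpoly (h P) (coeff_vec l) = 0"
    and h_vanishes: "v \<in> P \<Longrightarrow> eval_mpoly (h P) v = 0"
proof -
  note j = join[OF P, unfolded defines_join_def defines_hyperplane_def]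
  show "h P \<in> linear_forms" "h P \<noteq> 0" using j by blast+
  show ker: "eval_mpoly (h P) v = 0 \<longleftrightarrow> v \<in> vec.span (P \<union> {coeff_vec l})" for v
    using j by blast
  show "eval_mpoly (h P) (coeff_vec l) = 0" "v \<in> P \<Longrightarrow> eval_mpoly (h P) v = 0"
    unfolding ker by (auto intro: vec.span_base)
qed

lemma cluster_card:
  assumes P: "P \<in> codim2_intersections A"
  shows "card (cluster P) \<ge> 2"
proof -
  obtain H1 H2 where H: "H1 \<in> A" "H2 \<in> A" "H1 \<noteq> H2" "P = H1 \<inter> H2"
    using P by (auto simp: codim2_intersections_def)
  then have "card {H1, H2} \<le> card (cluster P)"
    by (intro card_mono finite_cluster) (auto simp: cluster_def)
  then show ?thesis using H by simp
qed

text \<open>Both forms vanish on \<open>P\<close> and are 1 at \<open>coeff_vec l\<close>, so their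
  difference vanishes on the join.\<close>

lemma cluster_dvd:
  assumes P: "P \<in> codim2_intersections A" and H: "H \<in> cluster P" "H0 \<in> cluster P"
  shows "h P dvd \<beta> H0 - \<beta> H"
proof -
  have HA: "H \<in> A" "H0 \<in> A" using H cluster_subset by blast+
  have "eval_mpoly (\<beta> H) v = 0" "eval_mpoly (\<beta> H0) v = 0" if "v \<in> P" for v
    using that H HA by (auto simp: cluster_def \<beta>_eq_0_iff)
  note van = this
  have "vec.span (P \<union> {coeff_vec l}) \<subseteq> {v. eval_mpoly (\<beta> H0 - \<beta> H) v = 0}"
  proof (rule vec.span_minimal)
    show "P \<union> {coeff_vec l} \<subseteq> {v. eval_mpoly (\<beta> H0 - \<beta> H) v = 0}"
      using HA van by auto
  qed (use HA in \<open>intro subspace_linear_form_kernel linear_forms_diff \<beta>_linear\<close>)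
  then show ?thesis using P by (auto simp: linear_form_dvd_iff vanishes_on_def h_kernel)
qed

text \<open>On the kernel of \<open>h P\<close> all forms of the cluster agree, so a zero of one of
  them is a zero of all, in particular of two whose hyperplanes intersect in
  \<open>P\<close>.\<close>

lemma codim2_eq:
  assumes P: "P \<in> codim2_intersections A" and H0: "H0 \<in> cluster P"
  shows "P = {v. eval_mpoly (h P) v = 0 \<and> eval_mpoly (\<beta> H0) v = 0}"
proof
  show "P \<subseteq> {v. eval_mpoly (h P) v = 0 \<and> eval_mpoly (\<beta> H0) v = 0}"
    using h_vanishes[OF P] H0 \<beta>_eq_0_iff by (auto simp: cluster_def)
  obtain H1 H2 where H: "H1 \<in> A" "H2 \<in> A" "H1 \<noteq> H2" "P = H1 \<inter> H2"
    using P by (auto simp: codim2_intersections_def)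
  show "{v. eval_mpoly (h P) v = 0 \<and> eval_mpoly (\<beta> H0) v = 0} \<subseteq> P"
  proof safe
    fix v assume v: "eval_mpoly (h P) v = 0" "eval_mpoly (\<beta> H0) v = 0"
    have "v \<in> H" if H: "H \<in> cluster P" for H
    proof -
      obtain s where "\<beta> H0 - \<beta> H = h P * s" using cluster_dvd[OF P H H0] by blast
      then have "eval_mpoly (\<beta> H0 - \<beta> H) v = 0" using v by simp
      then show ?thesis using v H \<beta>_eq_0_iff[of H] by (simp add: cluster_def)
    qed
    then show "v \<in> P" using H by (auto simp: cluster_def)
  qed
qed

lemma component_formE:
  assumes "P \<in> codim2_intersections A"
  obtains H0 where "H0 \<in> cluster P" "H0 \<in> A" "component_form P = \<beta> H0"
proof -
  have "cluster P \<noteq> {}" using cluster_card[OF assms] by auto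
  then have "(SOME H. H \<in> cluster P) \<in> cluster P" by (simp add: some_in_eq)
  then show ?thesis using that cluster_subset unfolding component_form_def by blast
qed

text \<open>The joins are nested, so their forms are proportional and the joins equal; a hyperplane
  through \<open>P'\<close> also contains \<open>P\<close> and cuts both subspaces out of that join.
  This excludes embedded components.\<close>

lemma codim2_subset_imp_eq:
  assumes P: "P \<in> codim2_intersections A" and P': "P' \<in> codim2_intersections A" and sub: "P \<subseteq> P'"
  shows "P = P'"
proof -
  obtain H0 where H0: "H0 \<in> cluster P'" "H0 \<in> A" using component_formE[OF P'] by metis
  have H0P: "H0 \<in> cluster P" using H0 sub by (auto simp: cluster_def)
  have "vec.span (P \<union> {coeff_vec l}) \<subseteq> vec.span (P' \<union> {coeff_vec l})"
    using sub by (intro vec.span_mono) auto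
  then obtain k where k: "h P' = const_mpoly k * h P"
    using linear_form_proportional[of "h P" "h P'"] P P' h_kernel by auto
  then have "k \<noteq> 0" using h_nonzero[OF P'] by auto
  then have "eval_mpoly (h P') v = 0 \<longleftrightarrow> eval_mpoly (h P) v = 0" for v
    by (simp add: k)
  then show ?thesis using codim2_eq[OF P H0P] codim2_eq[OF P' H0(1)] by auto
qed

text \<open>By \<open>codim2_eq\<close> the ideal \<open>(h P, component_form P)\<close> is the
  vanishing ideal of the subspace \<open>P\<close>, hence prime and proper; the general facts on
  \<open>(z, y^k)\<close> then apply with positive exponent.\<close>

lemma
  assumes P: "P \<in> codim2_intersections A"
  shows radical_base: "p \<in> ideal.span {h P, component_form P} \<longleftrightarrow> vanishes_on p P"
    and subspace_codim2: "vec.subspace P"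
    and component_primary: "primary_ideal (component P)"
    and component_radical: "ideal_radical (component P) = ideal.span {h P, component_form P}"
proof -
  obtain H0 where H0: "H0 \<in> cluster P" "H0 \<in> A" "component_form P = \<beta> H0" using component_formE[OF P] .
  note h = h_linear[OF P] h_nonzero[OF P] h_at[OF P]
  note nd = join_not_dvd(1)[OF h H0(2)]
  show iff: "p \<in> ideal.span {h P, component_form P} \<longleftrightarrow> vanishes_on p P" for p
    using mem_ideal_span_linear_forms_iff[OF h(1,2) \<beta>_linear nd] H0 codim2_eq[OF P H0(1)] by simp
  show sub: "vec.subspace P"
    by (subst codim2_eq[OF P H0(1)]) (use h H0 in \<open>simp add: vec.subspace_def\<close>)
  have one: "1 \<notin> ideal.span {h P, component_form P}"
    using vec.subspace_0[OF sub] by (auto simp: iff vanishes_on_def)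
  have exp: "component_exp P > 0" using cluster_card[OF P] by (simp add: component_exp_def)
  have prime: "p \<in> ideal.span {h P, component_form P} \<or> q \<in> ideal.span {h P, component_form P}"
    if "p * q \<in> ideal.span {h P, component_form P}" for p q
    using that vanishes_on_multD[OF sub] by (simp add: iff)
  show "ideal_radical (component P) = ideal.span {h P, component_form P}"
    unfolding component_def using prime one exp by (rule ideal_radical_span_power)
  show "primary_ideal (component P)"
    unfolding component_def using linear_form_prime[OF h(1,2)] nd[folded H0(3)] prime one exp
    by (rule primary_ideal_span_power)
qed

lemma component_subset:
  assumes "P \<in> codim2_intersections A" "p \<in> component P"
  shows "vanishes_on p P"
proof -
  have "p ^ 1 \<in> component P" using assms by simp
  then have "p \<in> ideal_radical (component P)" unfolding ideal_radical_def by blast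
  then show ?thesis using assms by (simp add: component_radical radical_base)
qed

lemma finite_codim2: "finite (codim2_intersections A)"
proof -
  have "codim2_intersections A \<subseteq> (\<lambda>(H, H'). H \<inter> H') ` (A \<times> A)"
    by (auto simp: codim2_intersections_def)
  then show ?thesis using finite_A finite_subset by blast
qed

lemma residual_eq_Inter: "residual \<alpha> A l = (\<Inter>P\<in>codim2_intersections A. component P)"
proof (intro equalityI subsetI INT_I)
  fix g P assume g: "g \<in> residual \<alpha> A l" and P: "P \<in> codim2_intersections A"
  obtain H0 where H0: "H0 \<in> cluster P" "H0 \<in> A" "component_form P = \<beta> H0" using component_formE[OF P] .
  have "interpolable g b (cluster P)" for b
    using g cluster_subset[of P] unfolding residual_iff[OF refl] interpolable_def by blast
  then show "g \<in> component P"
    unfolding component_def H0 component_exp_def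
    using P cluster_dvd[OF P _ H0(1)] H0(1) cluster_subset
    by (intro local_interpolation_necessary) auto
next
  fix g assume g: "g \<in> (\<Inter>P\<in>codim2_intersections A. component P)"
  have "interpolable g b A" for b
  proof (rule global_interpolation)
    fix z H0 assume z: "z \<in> linear_forms" "z \<noteq> 0" "eval_mpoly z (coeff_vec l) = 0" and H0: "H0 \<in> A"
    let ?C = "{H \<in> A. z dvd \<beta> H0 - \<beta> H}"
    show "interpolable g b ?C"
    proof (cases "?C \<subseteq> {H0}")
      \<comment> \<open>A single hyperplane is interpolated by its own datum.\<close>
      case True
      then show ?thesis
        unfolding interpolable_def by (intro exI[of _ "const_mpoly (eval_mpoly (\<beta> H0) b) * g"]) auto
    next
      case False
      then obtain H1 where H1: "H1 \<in> A" "z dvd \<beta> H0 - \<beta> H1" "H1 \<noteq> H0" by auto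
      define P where "P = H0 \<inter> H1"
      have P: "P \<in> codim2_intersections A"
        unfolding P_def codim2_intersections_def using H0 H1 by blast
      have H0P: "H0 \<in> cluster P" using H0 by (auto simp: cluster_def P_def)
      obtain t1 where t1: "\<beta> H1 = \<beta> H0 - const_mpoly t1 * z"
        using join_dvd_iff(2)[OF z H1(1) H0] H1 by blast
      \<comment> \<open>Thus \<open>z\<close> vanishes on \<open>P = H0 \<inter> H1\<close>, and
        every hyperplane of the class contains \<open>P\<close>.\<close>
      have "t1 \<noteq> 0" using t1 \<beta>_inj[of H1 H0] H0 H1 by auto
      have C: "?C \<subseteq> cluster P"
      proof
        fix H assume H: "H \<in> ?C"
        then obtain t where t: "\<beta> H = \<beta> H0 - const_mpoly t * z"
          using join_dvd_iff(2)[OF z _ H0] by blast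
        have "v \<in> H" if "v \<in> P" for v
        proof -
          have v: "eval_mpoly (\<beta> H0) v = 0" "eval_mpoly (\<beta> H1) v = 0"
            using that H0 H1 \<beta>_eq_0_iff by (auto simp: P_def)
          then have "eval_mpoly z v = 0" using \<open>t1 \<noteq> 0\<close> by (simp add: t1)
          then have "eval_mpoly (\<beta> H) v = 0" using v by (simp add: t)
          then show ?thesis using H \<beta>_eq_0_iff by blast
        qed
        then show "H \<in> cluster P" using H by (auto simp: cluster_def)
      qed
      obtain H2 where H2: "H2 \<in> cluster P" "H2 \<in> A" "component_form P = \<beta> H2" using component_formE[OF P] .
      have "g \<in> ideal.span {h P, \<beta> H2 ^ (card (cluster P) - 1)}"
        using g P by (auto simp: component_def component_exp_def H2(3))
      then have "interpolable g b (cluster P)"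
        using P cluster_dvd[OF P _ H2(1)] H2(1) cluster_subset
        by (intro local_interpolation_sufficient[of "h P" _ H2]) auto
      then show ?thesis using C unfolding interpolable_def by blast
    qed
  qed
  then show "g \<in> residual \<alpha> A l" by (simp add: residual_iff[OF refl])
qed

text \<open>At a point of \<open>P\<close> outside \<open>P'\<close> one of the two generators of
  \<open>component P'\<close> is nonzero. The product of these generators over all \<open>P'\<close>
  lies in the other components but does not vanish on \<open>P\<close>, while every element of
  \<open>component P\<close> does.\<close>

lemma component_irredundant:
  assumes P: "P \<in> codim2_intersections A"
  shows "\<not> (\<Inter>P'\<in>codim2_intersections A - {P}. component P') \<subseteq> component P"
proof
  let ?T = "codim2_intersections A - {P}"
  assume sub: "(\<Inter>P'\<in>?T. component P') \<subseteq> component P"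
  have "\<exists>w. w \<in> component P' \<and> \<not> vanishes_on w P" if P': "P' \<in> ?T" for P'
  proof -
    have P'2: "P' \<in> codim2_intersections A" using P' by blast
    have "\<not> P \<subseteq> P'" using codim2_subset_imp_eq[OF P P'2] P' by blast
    then obtain v where v: "v \<in> P" "v \<notin> P'" by blast
    obtain H0 where H0: "H0 \<in> cluster P'" "component_form P' = \<beta> H0" using component_formE[OF P'2] by metis
    have "eval_mpoly (h P') v \<noteq> 0 \<or> eval_mpoly (component_form P' ^ component_exp P') v \<noteq> 0"
      using v codim2_eq[OF P'2 H0(1)] H0(2) by auto
    then show ?thesis
    proof
      assume "eval_mpoly (h P') v \<noteq> 0"
      then show ?thesis using v unfolding component_def vanishes_on_def
        by (intro exI[of _ "h P'"]) (auto intro: ideal.span_base)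
    next
      assume "eval_mpoly (component_form P' ^ component_exp P') v \<noteq> 0"
      then show ?thesis using v unfolding component_def vanishes_on_def
        by (intro exI[of _ "component_form P' ^ component_exp P'"]) (auto intro: ideal.span_base)
    qed
  qed
  then obtain w where w: "\<And>P'. P' \<in> ?T \<Longrightarrow> w P' \<in> component P'" "\<And>P'. P' \<in> ?T \<Longrightarrow> \<not> vanishes_on (w P') P"
    by metis
  have fin: "finite ?T" using finite_codim2 by simp
  have "(\<Prod>P'\<in>?T. w P') \<in> component P'" if "P' \<in> ?T" for P'
  proof -
    have "(\<Prod>P'\<in>?T. w P') = (\<Prod>P'\<in>?T - {P'}. w P') * w P'"
      using fin that by (simp add: prod.remove mult.commute)
    then show ?thesis
      using ideal.span_scale[of "w P'"] w(1)[OF that] unfolding component_def by simp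
  qed
  then have "(\<Prod>P'\<in>?T. w P') \<in> component P" using sub by blast
  then have "vanishes_on (\<Prod>P'\<in>?T. w P') P" using component_subset[OF P] by blast
  then show False using vanishes_on_prodD[OF subspace_codim2[OF P] fin] w(2) by blast
qed

lemma component_decomposition:
  "minimal_primary_decomposition (residual \<alpha> A l) (codim2_intersections A) component"
  unfolding minimal_primary_decomposition_def
proof (intro conjI ballI)
  show "inj_on (\<lambda>P. ideal_radical (component P)) (codim2_intersections A)"
  proof (rule inj_onI)
    fix P P' assume P: "P \<in> codim2_intersections A" and P': "P' \<in> codim2_intersections A"
      and eq: "ideal_radical (component P) = ideal_radical (component P')"
    obtain H0 where H0: "H0 \<in> cluster P'" "component_form P' = \<beta> H0" using component_formE[OF P'] by metis
    have "h P' \<in> ideal_radical (component P')" "component_form P' \<in> ideal_radical (component P')"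
      unfolding component_radical[OF P'] by (auto intro: ideal.span_base)
    then have "vanishes_on (h P') P" "vanishes_on (component_form P') P"
      unfolding eq[symmetric] component_radical[OF P] radical_base[OF P] .
    then have "P \<subseteq> P'"
      unfolding vanishes_on_def H0(2) by (subst codim2_eq[OF P' H0(1)]) blast
    then show "P = P'" by (rule codim2_subset_imp_eq[OF P P'])
  qed
qed (use finite_codim2 residual_eq_Inter component_primary component_irredundant in blast)+

section \<open>Both descriptions of the components, by derivative and by quotient\<close>

lemma local_poly_eq: "local_poly \<alpha> A P = (\<Prod>H\<in>cluster P. \<alpha> H)"
proof -
  have "\<alpha> H \<in> homogeneous_ideal P \<longleftrightarrow> P \<subseteq> H" if H: "H \<in> A" for H
  proof
    assume "P \<subseteq> H"
    then have "(\<exists>d. homogeneous_of_degree d (\<alpha> H)) \<and> (\<forall>v\<in>P. eval_mpoly (\<alpha> H) v = 0)"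
      using \<alpha>_linear[OF H] mem_iff[OF H] unfolding linear_forms_def by blast
    then show "\<alpha> H \<in> homogeneous_ideal P"
      unfolding homogeneous_ideal_def by (intro ideal.span_base) simp
  next
    assume "\<alpha> H \<in> homogeneous_ideal P"
    moreover have "homogeneous_ideal P \<subseteq> {p. vanishes_on p P}"
      unfolding homogeneous_ideal_def
      by (rule ideal.span_minimal) (auto simp: vanishes_on_def ideal.subspace_def)
    ultimately show "P \<subseteq> H" using mem_iff[OF H] by (auto simp: vanishes_on_def)
  qed
  then have "{H \<in> A. \<alpha> H \<in> homogeneous_ideal P} = cluster P" by (auto simp: cluster_def)
  then show ?thesis by (simp add: local_poly_def)
qed

text \<open>Modulo \<open>h P\<close> each \<open>\<alpha> H'\<close> is its value at
  \<open>coeff_vec l\<close> times \<open>component_form P\<close>.\<close>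

lemma prod_cluster_remove:
  assumes P: "P \<in> codim2_intersections A" and H: "H \<in> cluster P"
  shows "h P dvd (\<Prod>H'\<in>cluster P - {H}. \<alpha> H') -
    const_mpoly (\<Prod>H'\<in>cluster P - {H}. eval_mpoly (\<alpha> H') (coeff_vec l)) * component_form P ^ component_exp P"
proof -
  obtain H0 where H0: "H0 \<in> cluster P" "component_form P = \<beta> H0" using component_formE[OF P] by metis
  let ?c = "\<lambda>H. const_mpoly (eval_mpoly (\<alpha> H) (coeff_vec l))"
  have "h P dvd (\<Prod>H'\<in>cluster P - {H}. \<alpha> H') - (\<Prod>H'\<in>cluster P - {H}. ?c H' * component_form P)"
  proof (rule dvd_prod_diff)
    fix H' assume H': "H' \<in> cluster P - {H}"
    then have "\<alpha> H' = ?c H' * \<beta> H'" using \<alpha>_eq cluster_subset by blast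
    then have "\<alpha> H' - ?c H' * component_form P = ?c H' * (\<beta> H' - \<beta> H0)"
      by (simp only: H0(2) right_diff_distrib)
    then show "h P dvd \<alpha> H' - ?c H' * component_form P"
      using cluster_dvd[OF P H0(1)] H' by (metis DiffD1 dvd_mult)
  qed
  then show ?thesis
    using H by (simp add: prod.distrib const_mpoly_prod component_exp_def)
qed

text \<open>By the product rule the derivative has one summand per hyperplane of the cluster, and
  modulo \<open>h P\<close> each is the same multiple \<open>\<kappa>\<close> of the power. In
  characteristic zero the number of summands is a unit.\<close>

lemma component_eq_deriv:
  assumes P: "P \<in> codim2_intersections A"
  shows "ideal.span {h P, form_deriv l (local_poly \<alpha> A P)} = component P"
proof -
  define e where "e H = eval_mpoly (\<alpha> H) (coeff_vec l)" for H
  define \<kappa> where "\<kappa> = (\<Prod>H\<in>cluster P. e H)"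
  let ?w = "component_form P ^ component_exp P"
  have \<kappa>: "\<kappa> \<noteq> 0" using cluster_subset[of P] by (auto simp: \<kappa>_def e_def)
  have "form_deriv l (local_poly \<alpha> A P) =
      (\<Sum>H\<in>cluster P. const_mpoly (e H) * (\<Prod>H'\<in>cluster P - {H}. \<alpha> H'))"
    unfolding form_deriv_eq local_poly_eq e_def
    using cluster_subset[of P] by (intro dir_deriv_prod) auto
  moreover have "(\<Sum>H\<in>cluster P. const_mpoly \<kappa> * ?w) =
      const_mpoly (of_nat (card (cluster P)) * \<kappa>) * ?w"
    by (simp add: const_mpoly_mult mult.assoc)
  moreover have "h P dvd (\<Sum>H\<in>cluster P. const_mpoly (e H) * (\<Prod>H'\<in>cluster P - {H}. \<alpha> H')
      - const_mpoly \<kappa> * ?w)"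
  proof (rule dvd_sum)
    fix H assume H: "H \<in> cluster P"
    have "\<kappa> = e H * (\<Prod>H'\<in>cluster P - {H}. e H')"
      using H by (simp add: \<kappa>_def prod.remove)
    then have "const_mpoly (e H) * (\<Prod>H'\<in>cluster P - {H}. \<alpha> H') - const_mpoly \<kappa> * ?w =
        const_mpoly (e H) * ((\<Prod>H'\<in>cluster P - {H}. \<alpha> H') -
          const_mpoly (\<Prod>H'\<in>cluster P - {H}. e H') * ?w)"
      by (simp add: const_mpoly_mult algebra_simps)
    then show "h P dvd const_mpoly (e H) * (\<Prod>H'\<in>cluster P - {H}. \<alpha> H') - const_mpoly \<kappa> * ?w"
      using prod_cluster_remove[OF P H] by (simp add: e_def)
  qed
  ultimately have "h P dvd form_deriv l (local_poly \<alpha> A P) -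
      const_mpoly (of_nat (card (cluster P)) * \<kappa>) * ?w"
    by (simp add: sum_subtractf)
  moreover have "of_nat (card (cluster P)) * \<kappa> \<noteq> 0"
    using \<kappa> cluster_card[OF P] by auto
  then have "const_mpoly (1 / (of_nat (card (cluster P)) * \<kappa>)) *
      const_mpoly (of_nat (card (cluster P)) * \<kappa>) = (1 :: ('k, 'v) mpoly)"
    by (simp add: mult_single)
  ultimately show ?thesis unfolding component_def by (rule ideal_span2_cong)
qed

text \<open>The divisor \<open>t\<close> is prime, so it is proportional to some
  \<open>\<alpha> H\<close> in the cluster, and \<open>q\<close> is a nonzero scalar times the
  product of the remaining forms.\<close>

lemma component_eq_quotient:
  assumes P: "P \<in> codim2_intersections A" and t: "t \<in> linear_forms" and tq: "t * q = local_poly \<alpha> A P"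
  shows "ideal.span {h P, q} = component P"
proof -
  have "eval_mpoly (local_poly \<alpha> A P) (coeff_vec l) \<noteq> 0"
    using cluster_subset[of P] by (auto simp: local_poly_eq eval_mpoly_prod)
  then have t0: "t \<noteq> 0" using tq by auto
  have "t dvd (\<Prod>H\<in>cluster P. \<alpha> H)" using tq by (metis dvd_triv_left local_poly_eq)
  from linear_form_dvd_prodD[OF t t0 finite_cluster this] obtain H where
    H: "H \<in> cluster P" "t dvd \<alpha> H" by blast
  have HA: "H \<in> A" using H cluster_subset by blast
  obtain k where k: "\<alpha> H = const_mpoly k * t"
    using linear_form_proportional[OF t t0 \<alpha>_linear[OF HA]] H t t0
    by (auto simp: linear_form_dvd_iff vanishes_on_def)
  have "k \<noteq> 0" using k \<alpha>_at[OF HA] by auto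
  let ?R = "\<Prod>H'\<in>cluster P - {H}. \<alpha> H'"
  have "t * (q - const_mpoly k * ?R) = 0"
    using tq H by (simp add: local_poly_eq prod.remove k algebra_simps)
  then have q: "q = const_mpoly k * ?R" using mpoly_mult_eq_0D t0 by fastforce
  let ?c = "\<Prod>H'\<in>cluster P - {H}. eval_mpoly (\<alpha> H') (coeff_vec l)"
  have "h P dvd q - const_mpoly (k * ?c) * component_form P ^ component_exp P"
    using dvd_mult[OF prod_cluster_remove[OF P H(1)], of "const_mpoly k"]
    by (simp add: q const_mpoly_mult algebra_simps)
  moreover have "k * ?c \<noteq> 0" using \<open>k \<noteq> 0\<close> cluster_subset[of P] by auto
  then have "const_mpoly (1 / (k * ?c)) * const_mpoly (k * ?c) = (1 :: ('k, 'v) mpoly)"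
    by (simp add: mult_single)
  ultimately show ?thesis unfolding component_def by (rule ideal_span2_cong)
qed

end

text \<open>\<open>U\<close> is the set of linear forms whose coefficient vector lies on no
  hyperplane of \<open>A\<close>; it depends only on \<open>A\<close>, not on the chosen defining
  forms. The existence of joins is asserted separately, so that the quantification over
  \<open>h\<close> is not vacuous.\<close>

theorem proposition4p6:
  fixes A :: "('k::field_char_0 ^ 'v::finite) set set"
  assumes "CARD('v) \<ge> 3"
    and "hyperplane_arrangement A"
  shows "\<exists>U :: ('k, 'v) mpoly set. zariski_open_forms U \<and> U \<noteq> {} \<and>
    (\<forall>l\<in>U. l \<noteq> 0 \<and>
      (\<forall>P\<in>codim2_intersections A. \<exists>h. defines_join h P l) \<and>
      (\<forall>\<alpha>. (\<forall>H\<in>A. defines_hyperplane (\<alpha> H) H) \<longrightarrow>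
        (\<forall>h. (\<forall>P\<in>codim2_intersections A. defines_join (h P) P l) \<longrightarrow>
          minimal_primary_decomposition (residual \<alpha> A l) (codim2_intersections A)
            (\<lambda>P. ideal.span {h P, form_deriv l (local_poly \<alpha> A P)}) \<and>
          (\<forall>t q. (\<forall>P\<in>codim2_intersections A.
                    t P \<in> linear_forms \<and> t P * q P = local_poly \<alpha> A P) \<longrightarrow>
            minimal_primary_decomposition (residual \<alpha> A l) (codim2_intersections A)
              (\<lambda>P. ideal.span {h P, q P})))))"
proof -
  have A: "finite A" "A \<noteq> {}" "\<forall>H\<in>A. \<exists>h. defines_hyperplane h H"
    using assms(2) by (auto simp: hyperplane_arrangement_def)
  then obtain \<alpha>0 where \<alpha>0: "\<And>H. H \<in> A \<Longrightarrow> defines_hyperplane (\<alpha>0 H) H" by metis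
  define f where "f = arr_poly \<alpha>0 A"
  define U where "U = {l \<in> linear_forms. eval_mpoly f (coeff_vec l) \<noteq> 0}"
  have f: "eval_mpoly f v \<noteq> 0 \<longleftrightarrow> (\<forall>H\<in>A. v \<notin> H)" for v
    using A(1) \<alpha>0 by (auto simp: f_def arr_poly_def eval_mpoly_prod defines_hyperplane_def)
  have "zariski_open_forms U"
    unfolding zariski_open_forms_def U_def by (intro exI[of _ "{f}"]) simp
  moreover have "U \<noteq> {}"
  proof -
    have "\<not> vanishes_on f UNIV"
    proof
      assume "vanishes_on f UNIV"
      then obtain H where "H \<in> A" "vanishes_on (\<alpha>0 H) UNIV"
        unfolding f_def arr_poly_def using vanishes_on_prodD[OF vec.subspace_UNIV A(1)] by blast
      then show False using \<alpha>0 by (auto simp: vanishes_on_UNIV_iff defines_hyperplane_def)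
    qed
    then obtain v where v: "eval_mpoly f v \<noteq> 0" by (auto simp: vanishes_on_def)
    obtain l where "l \<in> linear_forms" "coeff_vec l = v" using coeff_vec_surj by blast
    then show ?thesis using v by (auto simp: U_def)
  qed
  moreover have "l \<noteq> 0" if "l \<in> U" for l
  proof
    \<comment> \<open>The zero vector lies in every hyperplane, and \<open>A\<close> is
      nonempty.\<close>
    assume "l = 0"
    then have "coeff_vec l = 0" by (simp add: coeff_vec_def vec_eq_iff)
    moreover obtain H where "H \<in> A" using A(2) by blast
    moreover have "0 \<in> H" if "H \<in> A" for H
      using \<alpha>0[OF that] linear_form_0 by (auto simp: defines_hyperplane_def)
    ultimately show False using that f by (auto simp: U_def)
  qed
  moreover have "arrangement_direction A \<alpha> (coeff_vec l)"
    if "l \<in> U" "\<forall>H\<in>A. defines_hyperplane (\<alpha> H) H" for \<alpha> l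
    by unfold_locales (use A that f in \<open>auto simp: U_def\<close>)
  note dir = this
  have "\<exists>h. defines_join h P l" if "l \<in> U" "P \<in> codim2_intersections A" for l P
    by (rule arrangement_direction.join_exists[OF dir[OF that(1), of \<alpha>0] refl that(2)]) (use \<alpha>0 in blast)
  moreover have "minimal_primary_decomposition (residual \<alpha> A l) (codim2_intersections A)
            (\<lambda>P. ideal.span {h P, form_deriv l (local_poly \<alpha> A P)}) \<and>
          (\<forall>t q. (\<forall>P\<in>codim2_intersections A.
                    t P \<in> linear_forms \<and> t P * q P = local_poly \<alpha> A P) \<longrightarrow>
            minimal_primary_decomposition (residual \<alpha> A l) (codim2_intersections A)
              (\<lambda>P. ideal.span {h P, q P}))"
    if "l \<in> U" "\<forall>H\<in>A. defines_hyperplane (\<alpha> H) H" "\<forall>P\<in>codim2_intersections A. defines_join (h P) P l"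
    for l \<alpha> h
  proof -
    interpret arrangement_direction A \<alpha> "coeff_vec l" using dir that by blast
    interpret arrangement_joins A \<alpha> l h by unfold_locales (use that in blast)
    show ?thesis
    proof (intro conjI allI impI)
      show "minimal_primary_decomposition (residual \<alpha> A l) (codim2_intersections A)
          (\<lambda>P. ideal.span {h P, form_deriv l (local_poly \<alpha> A P)})"
        using component_decomposition component_eq_deriv
        by (rule minimal_primary_decomposition_cong[THEN iffD2, rotated])
      fix t q
      assume "\<forall>P\<in>codim2_intersections A. t P \<in> linear_forms \<and> t P * q P = local_poly \<alpha> A P"
      then have "ideal.span {h P, q P} = component P" if "P \<in> codim2_intersections A" for P
        using that component_eq_quotient by blast
      with component_decomposition show "minimal_primary_decomposition (residual \<alpha> A l)
          (codim2_intersections A) (\<lambda>P. ideal.span {h P, q P})"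
        by (rule minimal_primary_decomposition_cong[THEN iffD2, rotated])
    qed
  qed
  ultimately show ?thesis by blast
qed

end
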